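(* Let $p\in(0,2]$. There is a constant $C(p)>0$ depending only on $p$ such that the following holds. Let $N\ge 2$ and let $\mathcal{D}_N=\{g_1,\dots,g_N\}\subset C(\Omega)$ be a system such that $$\|g_j\|_\infty\le 1\qquad\text{for all } j\in\{1,\dots,N\},$$ and assume that there is a constant $K\ge 1$ such that for any $(a_1,\dots,a_N)\in\mathbb{C}^N$ $$\sum_{j=1}^N|a_j|^2\le K\Bigl\|\sum_{j=1}^N a_jg_j\Bigr\|_2^2 .$$ Let $1\le v\le N$ be an integer. Then $$m(\mathcal{X}_v(\mathcal{D}_N),p)\le C(p)\,Kv\,\log N\,[\log(2Kv)+\log\log N]^3 .$$ Moreover, for any $\varepsilon\in(0,1/2]$ there are $$m\le C(p)\,\varepsilon^{-2}[\log\varepsilon^{-1}]^3\,Kv\,\log N\,[\log(2Kv)+\log\log(2N)]^3$$ points $\xi^1,\dots,\xi^m\in\Omega$ such that $$(1-\varepsilon)\|f\|_p^p\le\frac1m\sum_{j=1}^m|f(\xi^j)|^p\le(1+\varepsilon)\|f\|_p^p\qquad\text{for all } f\in\Sigma_v(\mathcal{D}_N).$$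
   Context: $\Omega$ is a compact subset of $\mathbb{R}^d$, $\mu$ is a (Borel) probability measure on $\Omega$, $C(\Omega)$ is the space of continuous complex-valued functions on $\Omega$, $\|f\|_\infty=\sup_{x\in\Omega}|f(x)|$, and $\|f\|_p^p=\int_\Omega|f|^p\,d\mu$ for $0<p<\infty$. $\log$ is the logarithm to base 2. For $J\subset\{1,\dots,N\}$ put $V_J(\mathcal{D}_N)=\operatorname{span}\{g_j:j\in J\}$. $\mathcal{X}_v(\mathcal{D}_N)$ is the collection of all linear spaces $V_J(\mathcal{D}_N)$ with $|J|=v$, and $\Sigma_v(\mathcal{D}_N)=\bigcup_{|J|=v}V_J(\mathcal{D}_N)$ is the set of all $v$-term approximants with respect to $\mathcal{D}_N$. For a finite collection $\mathcal{X}=\{X(n)\}_{n=1}^k$ of finite-dimensional linear subspaces of $C(\Omega)$, $m(\mathcal{X},p)$ denotes the minimal $m$ such that there exists a set of $m$ points $\xi^1,\dots,\xi^m\in\Omega$ with $$\frac12\|f\|_p^p\le\frac1m\sum_{j=1}^m|f(\xi^j)|^p\le\frac32\|f\|_p^p\qquad\text{for any } f\in\bigcup_{n=1}^kX(n).$$ *)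

theory Defs
  imports "HOL-Probability.Probability" "HOL-Library.Function_Algebras"
begin

text \<open>
  The points of R^d are the elements of \<^term>\<open>topspace (Euclidean_space d)\<close>, so that the
  dimension is an ordinary natural number and constants can be chosen before it.  The ambient type
  \<^typ>\<open>nat \<Rightarrow> real\<close> carries the product topology; hence compactness, continuity and
  the Borel sets of a subset of R^d are those of the ambient type:
\<close>

lemma compactin_Euclidean_space_iff:
  "compactin (Euclidean_space d) \<Omega> \<longleftrightarrow> compact \<Omega> \<and> \<Omega> \<subseteq> topspace (Euclidean_space d)"
  by (auto simp: Euclidean_space_def euclidean_product_topology compactin_subtopology)

lemma continuous_map_Euclidean_space_iff:
  assumes "\<Omega> \<subseteq> topspace (Euclidean_space d)"
  shows "continuous_map (subtopology (Euclidean_space d) \<Omega>) euclidean f \<longleftrightarrow> continuous_on \<Omega> f"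
proof -
  have "subtopology (Euclidean_space d) \<Omega> = top_of_set \<Omega>"
    using assms
    by (simp add: Euclidean_space_def euclidean_product_topology subtopology_subtopology
        Int_absorb1)
  then show ?thesis by simp
qed

text \<open>Functions on \<open>\<Omega>\<close> are represented by functions on the whole type; their values outside
  \<open>\<Omega>\<close> never matter below.\<close>

definition sup_norm :: "'a set \<Rightarrow> ('a \<Rightarrow> complex) \<Rightarrow> real" where
  "sup_norm \<Omega> f = (SUP x\<in>\<Omega>. cmod (f x))"

definition Lp_norm_pow :: "'a measure \<Rightarrow> real \<Rightarrow> ('a \<Rightarrow> complex) \<Rightarrow> real" where
  "Lp_norm_pow M p f = (LINT x|M. cmod (f x) powr p)"

definition cscale :: "complex \<Rightarrow> ('a \<Rightarrow> complex) \<Rightarrow> 'a \<Rightarrow> complex" where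
  "cscale c f = (\<lambda>x. c * f x)"

interpretation cfun: vector_space "cscale :: complex \<Rightarrow> ('a \<Rightarrow> complex) \<Rightarrow> 'a \<Rightarrow> complex"
  by unfold_locales (auto simp: cscale_def fun_eq_iff algebra_simps)

definition V_space :: "(nat \<Rightarrow> 'a \<Rightarrow> complex) \<Rightarrow> nat set \<Rightarrow> ('a \<Rightarrow> complex) set" where
  "V_space g J = module.span cscale (g ` J)"

definition X_spaces :: "nat \<Rightarrow> (nat \<Rightarrow> 'a \<Rightarrow> complex) \<Rightarrow> nat \<Rightarrow> ('a \<Rightarrow> complex) set set" where
  "X_spaces N g v = {V_space g J | J. J \<subseteq> {1..N} \<and> card J = v}"

definition Sigma_terms :: "nat \<Rightarrow> (nat \<Rightarrow> 'a \<Rightarrow> complex) \<Rightarrow> nat \<Rightarrow> ('a \<Rightarrow> complex) set" where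
  "Sigma_terms N g v = (\<Union>J\<in>{J. J \<subseteq> {1..N} \<and> card J = v}. V_space g J)"

text \<open>The points \<open>\<xi> 1, \<dots>, \<xi> m\<close> need not be distinct: with equal weights, distinct points cannot
  discretize an arbitrary probability measure (e.g. one with atoms).\<close>

definition discretizes ::
  "'a set \<Rightarrow> 'a measure \<Rightarrow> real \<Rightarrow> real \<Rightarrow> real \<Rightarrow> ('a \<Rightarrow> complex) set \<Rightarrow> nat \<Rightarrow> (nat \<Rightarrow> 'a) \<Rightarrow> bool" where
  "discretizes \<Omega> M p a b F m \<xi> \<longleftrightarrow>
     m \<ge> 1 \<and> (\<forall>j\<in>{1..m}. \<xi> j \<in> \<Omega>) \<and>
     (\<forall>f\<in>F. a * Lp_norm_pow M p f \<le> 1 / real m * (\<Sum>j=1..m. cmod (f (\<xi> j)) powr p) \<and>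
            1 / real m * (\<Sum>j=1..m. cmod (f (\<xi> j)) powr p) \<le> b * Lp_norm_pow M p f)"

text \<open>An infimum in \<^typ>\<open>enat\<close>: a minimum if some \<open>m\<close> is admissible, and \<open>\<infinity>\<close> otherwise.\<close>

definition m_discr :: "'a set \<Rightarrow> 'a measure \<Rightarrow> ('a \<Rightarrow> complex) set set \<Rightarrow> real \<Rightarrow> enat" where
  "m_discr \<Omega> M \<X> p = Inf {enat m | m. \<exists>\<xi>. discretizes \<Omega> M p (1/2) (3/2) (\<Union>\<X>) m \<xi>}"

end

theory Submission
  imports Defs "HOL-Real_Asymp.Real_Asymp"
begin

text \<open>
  The points are found by repeated halving. The measure is first replaced by the uniform average
  over a huge finite sequence of points, of length \<open>2\<^sup>r m\<close>; how large \<open>r\<close> is does not matter. Then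
  the sequence is halved \<open>r\<close> times: the points are paired and one point of each pair is kept, chosen by
  fair coin flips. If \<open>h i\<close> is the value of \<open>|f|\<^sup>p\<close> at the \<open>i\<close>-th of \<open>M = 2n\<close> points, then the average
  changes by \<open>1/M\<close> times the sum of \<open>\<plusminus>(h i - h (i + n))\<close>, a Rademacher sum. So everything rests on one
  estimate (\<open>chaining\<close>): with probability above one half these sums are small simultaneously for all
  \<open>v\<close>-sparse \<open>f\<close> of empirical \<open>p\<close>-norm at most one. The error of a step behaves like \<open>M\<close> to the power
  \<open>-1/2\<close> up to logarithms, so the last halvings dominate and the errors of all steps add up to \<open>\<epsilon>\<close>
  (\<open>repeated_halving\<close>).

  The estimate is a chaining argument. It needs nets of the unit ball in the maximum norm over the
  points, and these come from three facts. Maurey's empirical method (\<open>maurey_net\<close>): linear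
  combinations with coefficients of \<open>\<ell>\<^sub>1\<close>-norm at most \<open>A\<close> have a net of radius \<open>\<rho>\<close> whose
  cardinality has logarithm of order \<open>(A/\<rho>)\<^sup>2 log M log N\<close>. The Riesz condition: for sparse
  coefficients, the square of the \<open>\<ell>\<^sub>1\<close>-norm is at most of order \<open>K v\<close> times the squared \<open>2\<close>-norm of
  the function. Interpolation: a function bounded by \<open>t\<close> with \<open>p\<close>-norm of order one has squared
  \<open>2\<close>-norm of order \<open>t\<close> to the power \<open>2 - p\<close>. Therefore the elements of the ball that
  are within \<open>t\<close> of a given one can be covered at radius \<open>t/2\<close> at a logarithmic cost of order
  \<open>K v t\<^sup>-\<^sup>p log M log N\<close>. Summing over dyadic radii gives nets of this same logarithmic size (\<open>nets\<close>),
  a geometric series dominated by its last term. On the other hand, replacing \<open>f\<close> by a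
  function at distance \<open>t\<close> changes \<open>|f|\<^sup>p\<close> by a vector of squared Euclidean norm of order \<open>M t\<^sup>p\<close>
  (\<open>powr_diff_squared_le\<close>). The powers of \<open>t\<close> cancel, so that every dyadic scale contributes the
  same amount, of order \<open>M K v log M log N\<close> under the square root; the number of scales is
  logarithmic in \<open>K v / \<epsilon>\<close>. This yields three logarithms besides \<open>log N\<close>.

  The interpolation step uses the \<open>2\<close>-norm of differences with respect to the current points.
  Each halving therefore controls two things at once, the \<open>p\<close>-norm on \<open>v\<close>-sparse combinations and the
  \<open>2\<close>-norm on \<open>2v\<close>-sparse ones (\<open>halving\<close>), and so passes the Riesz condition on to the next step.
\<close>

section \<open>Elementary inequalities for powers\<close>

lemma powr_subadditive:
  fixes x y s :: real
  assumes "0 \<le> x" "0 \<le> y" "0 < s" "s \<le> 1"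
  shows "(x + y) powr s \<le> x powr s + y powr s"
proof (cases "x + y = 0")
  case True
  then show ?thesis using assms by simp
next
  case False
  then have pos: "x + y > 0" using assms by simp
  have frac: "u / (x + y) \<le> u powr s / (x + y) powr s" if "0 \<le> u" "u \<le> x + y" for u
  proof -
    have "(u / (x + y)) powr 1 \<le> (u / (x + y)) powr s"
      using that pos assms by (intro powr_mono') auto
    then show ?thesis using that pos by (simp add: powr_divide)
  qed
  have "1 = x / (x + y) + y / (x + y)"
    using pos by (simp add: add_divide_distrib[symmetric])
  also have "\<dots> \<le> (x powr s + y powr s) / (x + y) powr s"
    using frac[of x] frac[of y] assms by (simp add: add_divide_distrib)
  finally show ?thesis using pos by (simp add: field_simps)
qed

text \<open>
  Writing \<open>a\<^sup>p - b\<^sup>p\<close> as a difference of squares of \<open>(p/2)\<close>-th powers, one factor is at most \<open>t\<close> to the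
  power \<open>p/2\<close> because \<open>p/2 \<le> 1\<close>. The bound is linear in \<open>a\<^sup>p + b\<^sup>p\<close>, so that it can be
  summed over points when only the \<open>p\<close>-norms are known.
\<close>
lemma powr_diff_squared_le:
  fixes a b p t :: real
  assumes p: "0 < p" "p \<le> 2" and ab: "0 \<le> a" "0 \<le> b" and t: "\<bar>a - b\<bar> \<le> t"
  shows "(a powr p - b powr p)\<^sup>2 \<le> 2 * t powr p * (a powr p + b powr p)"
  using ab t
proof (induction a b rule: linorder_wlog)
  case (le a b)
  define \<alpha> \<beta> where "\<alpha> = a powr (p/2)" and "\<beta> = b powr (p/2)"
  have sq: "a powr p = \<alpha>\<^sup>2" "b powr p = \<beta>\<^sup>2" "t powr p = (t powr (p/2))\<^sup>2"
    by (simp_all add: \<alpha>_def \<beta>_def power2_eq_square powr_add[symmetric])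
  have nn: "0 \<le> \<alpha>" "\<alpha> \<le> \<beta>"
    using le p by (auto simp: \<alpha>_def \<beta>_def intro!: powr_mono2)
  have "\<beta> = (a + (b - a)) powr (p/2)" by (simp add: \<beta>_def)
  also have "\<dots> \<le> \<alpha> + (b - a) powr (p/2)"
    unfolding \<alpha>_def using le p by (intro powr_subadditive) auto
  also have "(b - a) powr (p/2) \<le> t powr (p/2)"
    using le p by (intro powr_mono2) auto
  finally have 1: "\<beta> - \<alpha> \<le> t powr (p/2)" by simp
  have "(a powr p - b powr p)\<^sup>2 = (\<beta> - \<alpha>)\<^sup>2 * (\<alpha> + \<beta>)\<^sup>2"
    unfolding sq by (simp add: power2_eq_square algebra_simps)
  also have "\<dots> \<le> (t powr (p/2))\<^sup>2 * (\<alpha> + \<beta>)\<^sup>2"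
    using 1 nn by (intro mult_right_mono power_mono) auto
  also have "\<dots> \<le> (t powr (p/2))\<^sup>2 * (2 * (\<alpha>\<^sup>2 + \<beta>\<^sup>2))"
    using sum_squares_ge_zero[of "\<alpha> - \<beta>" 0]
    by (intro mult_left_mono) (auto simp: power2_eq_square algebra_simps)
  finally show ?case by (simp add: sq algebra_simps)
next
  case (sym a b)
  then show ?case by (simp add: power2_commute abs_minus_commute add.commute)
qed

lemma cmod_diff_powr_le:
  assumes "0 < p" "p \<le> 2"
  shows "cmod (z - w) powr p \<le> 4 * (cmod z powr p + cmod w powr p)"
proof -
  define m where "m = max (cmod z) (cmod w)"
  have "cmod (z - w) \<le> cmod z + cmod w" by (rule norm_triangle_ineq4)
  then have "cmod (z - w) powr p \<le> (2 * m) powr p"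
    using assms by (intro powr_mono2) (auto simp: m_def)
  also have "\<dots> = 2 powr p * m powr p"
    by (simp add: powr_mult m_def)
  also have "\<dots> \<le> 2 powr 2 * m powr p"
    using assms by (intro mult_right_mono powr_mono) auto
  also have "m powr p \<le> cmod z powr p + cmod w powr p"
    by (auto simp: m_def max_def)
  finally show ?thesis by simp
qed

lemma one_add_half_le_two_powr:
  fixes p :: real assumes "0 \<le> p" shows "1 + p / 2 \<le> 2 powr p"
proof -
  have "(1::real) / 2 \<le> ln 2" using ln2_ge_two_thirds by simp
  then have "1 + p / 2 \<le> 1 + p * ln 2" using assms mult_left_mono[of "1/2" "ln 2" p] by simp
  also have "\<dots> \<le> exp (p * ln 2)" by (rule exp_ge_add_one_self)
  finally show ?thesis by (simp add: powr_def)
qed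

section \<open>Finite-dimensional probability\<close>

text \<open>
  Hoeffding's inequality for independent draws from one distribution, with a variance proxy \<open>\<sigma>2\<close> that
  may be any upper bound; in particular all \<open>c i\<close> may vanish.
\<close>
lemma prob_Pi_pmf_abs_sum_ge:
  fixes f :: "'i \<Rightarrow> 'b \<Rightarrow> real"
  assumes fin: "finite I" and bd: "\<And>i y. i \<in> I \<Longrightarrow> y \<in> set_pmf q \<Longrightarrow> \<bar>f i y\<bar> \<le> c i"
    and mean: "\<And>i. i \<in> I \<Longrightarrow> measure_pmf.expectation q (f i) = 0"
    and c: "(\<Sum>i\<in>I. (c i)\<^sup>2) \<le> \<sigma>2" and \<sigma>2: "0 < \<sigma>2" and u: "0 < u"
  shows "measure_pmf.prob (Pi_pmf I d (\<lambda>_. q)) {\<omega>. u \<le> \<bar>\<Sum>i\<in>I. f i (\<omega> i)\<bar>}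
           \<le> 2 * exp (- u\<^sup>2 / (2 * \<sigma>2))"
proof -
  define P where "P = Pi_pmf I d (\<lambda>_. q)"
  have sub: "y i \<in> set_pmf q" if "y \<in> set_pmf P" "i \<in> I" for y i
    using set_Pi_pmf_subset'[OF fin, of d "\<lambda>_. q"] that by (auto simp: P_def PiE_dflt_def)
  interpret H: Hoeffding_ineq "measure_pmf P" I "\<lambda>i \<omega>. f i (\<omega> i)" "\<lambda>i. - c i" c 0
  proof unfold_locales
    show "finite I" by fact
    show "prob_space.indep_vars (measure_pmf P) (\<lambda>_. borel) (\<lambda>i \<omega>. f i (\<omega> i)) I"
      unfolding P_def
      by (rule prob_space.indep_vars_compose2[OF measure_pmf.prob_space_axioms
            indep_vars_Pi_pmf[OF fin]]) auto
    show "AE x in measure_pmf P. f i (x i) \<in> {- c i..c i}" if "i \<in> I" for i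
    proof (rule AE_pmfI)
      fix y assume "y \<in> set_pmf P"
      then show "f i (y i) \<in> {- c i..c i}" using bd[OF that sub[OF _ that]] by fastforce
    qed
    have "measure_pmf.expectation P (\<lambda>\<omega>. f i (\<omega> i)) = 0" if "i \<in> I" for i
    proof -
      have "measure_pmf.expectation P (\<lambda>\<omega>. f i (\<omega> i))
          = measure_pmf.expectation (map_pmf (\<lambda>\<omega>. \<omega> i) P) (f i)"
        by simp
      also have "map_pmf (\<lambda>\<omega>. \<omega> i) P = q"
        unfolding P_def using that by (simp add: Pi_pmf_component[OF fin])
      finally show ?thesis using mean[OF that] by simp
    qed
    then show "0 \<equiv> \<Sum>i\<in>I. measure_pmf.expectation P (\<lambda>\<omega>. f i (\<omega> i))"
      by (intro eq_reflection) simp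
  qed
  have S: "(\<Sum>i\<in>I. (c i - - c i)\<^sup>2) = 4 * (\<Sum>i\<in>I. (c i)\<^sup>2)"
    by (simp add: sum_distrib_left power2_eq_square algebra_simps)
  show ?thesis
  proof (cases "(\<Sum>i\<in>I. (c i)\<^sup>2) = 0")
    case True
    then have "c i = 0" if "i \<in> I" for i
      using that fin by (simp add: sum_nonneg_eq_0_iff)
    then have "AE \<omega> in measure_pmf P. \<not> u \<le> \<bar>\<Sum>i\<in>I. f i (\<omega> i)\<bar>"
      using bd sub u by (intro AE_pmfI) (auto intro!: sum.neutral simp: not_le)
    then have "measure_pmf.prob P {\<omega>. u \<le> \<bar>\<Sum>i\<in>I. f i (\<omega> i)\<bar>} = 0"
      by (subst measure_pmf.prob_eq_0) auto
    then show ?thesis by (simp add: P_def)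
  next
    case False
    moreover have "0 \<le> (\<Sum>i\<in>I. (c i)\<^sup>2)" by (intro sum_nonneg) auto
    ultimately have pos: "0 < (\<Sum>i\<in>I. (c i)\<^sup>2)" by linarith
    have "measure_pmf.prob P {\<omega>. u \<le> \<bar>\<Sum>i\<in>I. f i (\<omega> i)\<bar>}
        \<le> 2 * exp (- 2 * u\<^sup>2 / (4 * (\<Sum>i\<in>I. (c i)\<^sup>2)))"
      using H.Hoeffding_ineq_abs_ge[of u] u pos unfolding S by simp
    also have "\<dots> \<le> 2 * exp (- u\<^sup>2 / (2 * \<sigma>2))"
      using c pos \<sigma>2 by (simp add: frac_le)
    finally show ?thesis by (simp add: P_def)
  qed
qed

lemma pmf_of_weights:
  fixes w :: "'b \<Rightarrow> real"
  assumes "finite A" "\<And>y. y \<in> A \<Longrightarrow> 0 \<le> w y" "sum w A = 1"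
  obtains q where "set_pmf q \<subseteq> A" "\<And>h :: 'b \<Rightarrow> real. measure_pmf.expectation q h = (\<Sum>y\<in>A. w y * h y)"
proof -
  define q where "q = embed_pmf (\<lambda>y. if y \<in> A then w y else 0)"
  have "(\<integral>\<^sup>+y. ennreal (if y \<in> A then w y else 0) \<partial>count_space UNIV)
      = (\<Sum>y\<in>A. ennreal (if y \<in> A then w y else 0))"
    by (intro nn_integral_count_space'[OF assms(1)]) auto
  also have "\<dots> = (\<Sum>y\<in>A. ennreal (w y))" by simp
  also have "\<dots> = ennreal (sum w A)" using assms by (intro sum_ennreal) auto
  finally have pq: "pmf q y = (if y \<in> A then w y else 0)" for y
    unfolding q_def using assms by (subst pmf_embed_pmf) auto
  show thesis
  proof (rule that[of q])
    show sub: "set_pmf q \<subseteq> A" by (auto simp: set_pmf_eq pq split: if_splits)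
    show "measure_pmf.expectation q h = (\<Sum>y\<in>A. w y * h y)" for h :: "'b \<Rightarrow> real"
      using sub by (subst integral_measure_pmf_real[OF assms(1)]) (auto simp: pq mult.commute)
  qed
qed

lemma pmf_union_bound:
  assumes "finite I" "(\<Sum>k\<in>I. measure_pmf.prob P (bad k)) < 1"
  obtains \<omega> where "\<omega> \<in> set_pmf P" "\<And>k. k \<in> I \<Longrightarrow> \<omega> \<notin> bad k"
proof -
  have "measure_pmf.prob P (\<Union>k\<in>I. bad k) \<le> (\<Sum>k\<in>I. measure_pmf.prob P (bad k))"
    using assms(1) by (intro measure_pmf.finite_measure_subadditive_finite) auto
  then have "measure_pmf.prob P (\<Union>k\<in>I. bad k) \<noteq> 1" using assms(2) by simp
  then have "\<not> set_pmf P \<subseteq> (\<Union>k\<in>I. bad k)"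
    using measure_pmf.prob_eq_1[of "\<Union>k\<in>I. bad k" P] by (auto simp: AE_measure_pmf_iff)
  then show thesis using that by blast
qed

section \<open>Linear combinations of the dictionary\<close>

text \<open>
  A function in the span of the dictionary is handled through a coefficient vector \<open>a\<close>, of which only the
  entries \<open>a 1, \<dots>, a N\<close> count.
\<close>
definition lincomb :: "nat \<Rightarrow> (nat \<Rightarrow> 'a \<Rightarrow> complex) \<Rightarrow> (nat \<Rightarrow> complex) \<Rightarrow> 'a \<Rightarrow> complex" where
  "lincomb N g a t = (\<Sum>j=1..N. a j * g j t)"

definition l1 :: "nat \<Rightarrow> (nat \<Rightarrow> complex) \<Rightarrow> real" where
  "l1 N a = (\<Sum>j=1..N. cmod (a j))"

lemma l1_nonneg [simp]: "0 \<le> l1 N a"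
  by (simp add: l1_def sum_nonneg)

lemma lincomb_diff: "lincomb N g a t - lincomb N g b t = lincomb N g (\<lambda>j. a j - b j) t"
  by (simp add: lincomb_def sum_subtractf algebra_simps)

lemma lincomb_scale: "lincomb N g (\<lambda>j. c * a j) t = c * lincomb N g a t"
  by (simp add: lincomb_def sum_distrib_left mult.assoc)

lemma cmod_lincomb_le_l1:
  assumes "\<And>j. j \<in> {1..N} \<Longrightarrow> cmod (g j t) \<le> 1"
  shows "cmod (lincomb N g a t) \<le> l1 N a"
  unfolding lincomb_def l1_def
proof (rule order_trans[OF norm_sum sum_mono])
  fix j assume "j \<in> {1..N}"
  then show "cmod (a j * g j t) \<le> cmod (a j)"
    using assms mult_left_mono[of "cmod (g j t)" 1 "cmod (a j)"] by (simp add: norm_mult)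
qed

definition sparse_coeffs :: "nat \<Rightarrow> nat \<Rightarrow> (nat \<Rightarrow> complex) set" where
  "sparse_coeffs N w = {a. card {j\<in>{1..N}. a j \<noteq> 0} \<le> w}"

definition avg_pow :: "nat \<Rightarrow> (nat \<Rightarrow> 'a) \<Rightarrow> real \<Rightarrow> ('a \<Rightarrow> complex) \<Rightarrow> real" where
  "avg_pow M x p f = (\<Sum>i<M. cmod (f (x i)) powr p) / M"

lemma avg_pow_nonneg: "0 \<le> avg_pow M x p f"
  by (simp add: avg_pow_def sum_nonneg)

lemma zero_in_sparse: "(\<lambda>_. 0) \<in> sparse_coeffs N w"
  by (simp add: sparse_coeffs_def)

lemma sparse_scale:
  assumes "a \<in> sparse_coeffs N w" shows "(\<lambda>j. c * a j) \<in> sparse_coeffs N w"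
proof -
  have "card {j\<in>{1..N}. c * a j \<noteq> 0} \<le> card {j\<in>{1..N}. a j \<noteq> 0}"
    by (intro card_mono) auto
  then show ?thesis using assms by (simp add: sparse_coeffs_def)
qed

lemma sparse_diff:
  assumes "a \<in> sparse_coeffs N v" "b \<in> sparse_coeffs N w" shows "(\<lambda>j. a j - b j) \<in> sparse_coeffs N (v + w)"
proof -
  have "card {j\<in>{1..N}. a j - b j \<noteq> 0} \<le> card ({j\<in>{1..N}. a j \<noteq> 0} \<union> {j\<in>{1..N}. b j \<noteq> 0})"
    by (intro card_mono) auto
  also have "\<dots> \<le> card {j\<in>{1..N}. a j \<noteq> 0} + card {j\<in>{1..N}. b j \<noteq> 0}"
    by (rule card_Un_le)
  finally show ?thesis using assms by (simp add: sparse_coeffs_def)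
qed

lemma l1_squared_le:
  assumes "a \<in> sparse_coeffs N w"
  shows "(l1 N a)\<^sup>2 \<le> w * (\<Sum>j=1..N. (cmod (a j))\<^sup>2)"
proof -
  let ?J = "{j\<in>{1..N}. a j \<noteq> 0}"
  have "l1 N a = (\<Sum>j\<in>?J. 1 * cmod (a j))"
    unfolding l1_def by (rule sum.mono_neutral_cong_right) auto
  then have "(l1 N a)\<^sup>2 \<le> (\<Sum>j\<in>?J. 1\<^sup>2) * (\<Sum>j\<in>?J. (cmod (a j))\<^sup>2)"
    using Cauchy_Schwarz_ineq_sum[of "\<lambda>_. 1" "\<lambda>j. cmod (a j)" ?J] by simp
  also have "(\<Sum>j\<in>?J. (cmod (a j))\<^sup>2) = (\<Sum>j=1..N. (cmod (a j))\<^sup>2)"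
    by (rule sum.mono_neutral_cong_left) auto
  also have "(\<Sum>j\<in>?J. (1::real)\<^sup>2) \<le> w" using assms by (simp add: sparse_coeffs_def)
  finally show ?thesis by (simp add: mult_right_mono sum_nonneg)
qed

lemma l1_diff_le: "l1 N (\<lambda>j. a j - b j) \<le> l1 N a + l1 N b"
  unfolding l1_def sum.distrib[symmetric] by (intro sum_mono norm_triangle_ineq4)

section \<open>Maurey's empirical method\<close>

text \<open>
  Maurey's argument. Splitting the coefficients of \<open>a\<close> into their parts in the four directions \<open>1\<close>,
  \<open>-1\<close>, \<open>\<i>\<close>, \<open>-\<i>\<close> exhibits \<open>a\<close> as a convex combination of the atoms \<open>2 A d e\<^sub>j\<close> and \<open>0\<close>. The factor \<open>2\<close> is
  needed since \<open>|Re z| + |Im z|\<close> can exceed \<open>|z|\<close>, but is at most \<open>2 |z|\<close>. The average of \<open>n\<close> independent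
  atoms drawn with these weights has the right mean; by Hoeffding and a union bound over the real and imaginary
  parts at the \<open>M\<close> points, some outcome is uniformly close to it. The index \<open>None\<close> stands for the
  zero atom, which absorbs the remaining weight.
\<close>
lemma maurey_average:
  fixes g :: "nat \<Rightarrow> 'a \<Rightarrow> complex" and x :: "nat \<Rightarrow> 'a"
  defines "D \<equiv> {1, -1, \<i>, -\<i>}"
  assumes G: "\<And>i j. i < M \<Longrightarrow> j \<in> {1..N} \<Longrightarrow> cmod (g j (x i)) \<le> 1"
    and M: "1 \<le> M" and A: "0 < A" and \<rho>: "0 < \<rho>" and n: "1 \<le> n"
    and large: "72 * A\<^sup>2 * ln (8 * real M) \<le> \<rho>\<^sup>2 * real n"
    and a: "l1 N a \<le> A"
  defines "atom \<equiv> (\<lambda>y l. case y of None \<Rightarrow> 0 | Some (d, j) \<Rightarrow> if l = j then of_real (2 * A) * d else 0)"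
  shows "\<exists>\<omega>. (\<forall>l<n. \<omega> l \<in> insert None (Some ` (D \<times> {1..N}))) \<and>
     (\<forall>i<M. cmod (lincomb N g a (x i) - lincomb N g (\<lambda>j. (\<Sum>l<n. atom (\<omega> l) j) / n) (x i)) \<le> \<rho>)"
proof -
  define Y where "Y = insert None (Some ` (D \<times> {1..N}))"
  define part where "part = (\<lambda>d z. max 0 (Re (cnj d * z)))"
  have part_sum: "(\<Sum>d\<in>D. part d z) \<le> 2 * cmod z" for z
    using abs_Re_le_cmod[of z] abs_Im_le_cmod[of z]
    by (auto simp: D_def part_def complex_eq_iff max_def)
  have part_rep: "(\<Sum>d\<in>D. complex_of_real (part d z) * d) = z" for z
    by (auto simp: D_def part_def complex_eq_iff max_def)
  have part_nonneg: "0 \<le> part d z" for d z by (simp add: part_def)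
  have finY: "finite Y" by (simp add: Y_def D_def)
  have injS: "inj_on Some (D \<times> {1..N})" by simp
  define w where "w = (\<lambda>y. case y of
      None \<Rightarrow> 1 - (\<Sum>(d, j)\<in>D \<times> {1..N}. part d (a j) / (2 * A))
    | Some (d, j) \<Rightarrow> part d (a j) / (2 * A))"
  have sumY: "(\<Sum>y\<in>Y. h y) = h None + (\<Sum>j=1..N. \<Sum>d\<in>D. h (Some (d, j)))"
    for h :: "(complex \<times> nat) option \<Rightarrow> 'z::comm_monoid_add"
  proof -
    have "(\<Sum>y\<in>Y. h y) = h None + (\<Sum>y\<in>Some ` (D \<times> {1..N}). h y)"
      unfolding Y_def by (subst sum.insert) (auto simp: D_def)
    also have "(\<Sum>y\<in>Some ` (D \<times> {1..N}). h y) = (\<Sum>(d, j)\<in>D \<times> {1..N}. h (Some (d, j)))"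
      by (subst sum.reindex[OF injS]) (auto simp: case_prod_unfold)
    also have "\<dots> = (\<Sum>j=1..N. \<Sum>d\<in>D. h (Some (d, j)))"
      by (subst sum.cartesian_product[symmetric], rule sum.swap)
    finally show ?thesis .
  qed
  have tot: "(\<Sum>(d, j)\<in>D \<times> {1..N}. part d (a j) / (2 * A)) \<le> 1"
  proof -
    have "(\<Sum>(d, j)\<in>D \<times> {1..N}. part d (a j) / (2 * A)) = (\<Sum>j=1..N. (\<Sum>d\<in>D. part d (a j)) / (2 * A))"
      unfolding sum_divide_distrib
      by (subst sum.cartesian_product[symmetric], rule sum.swap)
    also have "\<dots> \<le> (\<Sum>j=1..N. (2 * cmod (a j)) / (2 * A))"
      using A by (intro sum_mono divide_right_mono part_sum) auto
    also have "\<dots> = l1 N a / A"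
      using A by (simp add: l1_def sum_divide_distrib)
    also have "\<dots> \<le> 1" using a A by simp
    finally show ?thesis .
  qed
  have w_nonneg: "0 \<le> w y" for y
    using tot part_nonneg A by (auto simp: w_def split: option.split)
  have w_sum: "sum w Y = 1"
  proof -
    have "(\<Sum>j=1..N. \<Sum>d\<in>D. w (Some (d, j))) = (\<Sum>(d, j)\<in>D \<times> {1..N}. part d (a j) / (2 * A))"
      unfolding w_def by (subst sum.cartesian_product[symmetric], subst sum.swap) simp
    then show ?thesis unfolding sumY by (simp add: w_def)
  qed
  obtain q where q: "set_pmf q \<subseteq> Y"
      "\<And>h :: _ \<Rightarrow> real. measure_pmf.expectation q h = (\<Sum>y\<in>Y. w y * h y)"
    using pmf_of_weights[OF finY w_nonneg w_sum] by blast
  define L where "L = (\<lambda>y i. lincomb N g (atom y) (x i))"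
  have L_None: "L None i = 0" for i by (simp add: L_def atom_def lincomb_def)
  have L_Some: "L (Some (d, j)) i = of_real (2 * A) * d * g j (x i)" if "j \<in> {1..N}" for d j i
  proof -
    have "L (Some (d, j)) i = (\<Sum>l=1..N. if l = j then of_real (2 * A) * d * g l (x i) else 0)"
      unfolding L_def atom_def lincomb_def by (intro sum.cong) auto
    then show ?thesis using that by (subst (asm) sum.delta) auto
  qed
  have L_bound: "cmod (L y i) \<le> 2 * A" if yi: "y \<in> Y" "i < M" for y i
  proof (cases y)
    case None
    then show ?thesis using A by (simp add: L_None)
  next
    case (Some dj)
    then obtain d j where y: "y = Some (d, j)" "d \<in> D" "j \<in> {1..N}"
      using yi Some by (auto simp: Y_def)
    have "cmod d = 1" using y by (auto simp: D_def)
    then show ?thesis using G[OF yi(2) y(3)] A y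
      by (simp add: L_Some norm_mult mult_left_le)
  qed
  have L_mean: "(\<Sum>y\<in>Y. of_real (w y) * L y i) = lincomb N g a (x i)" for i
  proof -
    have "(\<Sum>y\<in>Y. of_real (w y) * L y i)
        = (\<Sum>j=1..N. \<Sum>d\<in>D. of_real (part d (a j)) * d * g j (x i))"
      unfolding sumY using A
      by (auto simp: L_None L_Some w_def intro!: sum.cong)
    also have "\<dots> = (\<Sum>j=1..N. a j * g j (x i))"
      unfolding sum_distrib_right[symmetric] part_rep ..
    finally show ?thesis by (simp add: lincomb_def)
  qed
  define pr where "pr = (\<lambda>(b::bool) z. if b then Re z else Im z)"
  have pr_le: "\<bar>pr b z\<bar> \<le> cmod z" for b z
    by (simp add: pr_def abs_Re_le_cmod abs_Im_le_cmod)
  have pr_sum: "pr b (\<Sum>l\<in>T. f l) = (\<Sum>l\<in>T. pr b (f l))" for b and f :: "'y \<Rightarrow> complex" and T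
    by (simp add: pr_def)
  have pr_diff: "pr b (z - z') = pr b z - pr b z'" for b z z' by (simp add: pr_def)
  have pr_scale: "pr b (of_real r * z) = r * pr b z" for b r z by (simp add: pr_def)
  \<comment> \<open>The terms of the sum are bounded by \<open>3 A\<close>, so with this threshold each of the \<open>2 M\<close> bad events has
    probability at most \<open>2 / (8 M)\<close>.\<close>
  define u where "u = sqrt (18 * A\<^sup>2 * n * ln (8 * M))"
  have lnpos: "0 < ln (8 * real M)" using M by simp
  have u: "0 < u" "u\<^sup>2 = 18 * A\<^sup>2 * n * ln (8 * M)"
    using A n lnpos by (auto simp: u_def)
  define P where "P = Pi_pmf {..<n} None (\<lambda>_. q)"
  define bad where "bad = (\<lambda>(i, b). {\<omega>. u \<le> \<bar>\<Sum>l<n. pr b (L (\<omega> l) i - lincomb N g a (x i))\<bar>})"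
  have bad_prob: "measure_pmf.prob P (bad (i, b)) \<le> 1 / (4 * M)" if i: "i < M" for i b
  proof -
    have "measure_pmf.prob P (bad (i, b)) \<le> 2 * exp (- u\<^sup>2 / (2 * (n * (3 * A)\<^sup>2)))"
      unfolding P_def bad_def prod.case
    proof (rule prob_Pi_pmf_abs_sum_ge[where c = "\<lambda>_. 3 * A"])
      show "\<bar>pr b (L y i - lincomb N g a (x i))\<bar> \<le> 3 * A" if "y \<in> set_pmf q" for y
      proof -
        have "cmod (L y i - lincomb N g a (x i)) \<le> cmod (L y i) + cmod (lincomb N g a (x i))"
          by (rule norm_triangle_ineq4)
        also have "\<dots> \<le> 2 * A + A"
          using L_bound[of y i] q(1) that i cmod_lincomb_le_l1[of N g "x i" a] G a
          by (intro add_mono) (auto intro: order_trans)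
        finally show ?thesis using pr_le[of b "L y i - lincomb N g a (x i)"] by simp
      qed
      have "measure_pmf.expectation q (\<lambda>y. pr b (L y i - lincomb N g a (x i)))
          = (\<Sum>y\<in>Y. pr b (of_real (w y) * L y i)) - sum w Y * pr b (lincomb N g a (x i))"
        unfolding q(2) by (simp add: pr_diff pr_scale sum_subtractf right_diff_distrib sum_distrib_right)
      also have "\<dots> = 0"
        unfolding pr_sum[symmetric] L_mean w_sum by simp
      finally show "measure_pmf.expectation q (\<lambda>y. pr b (L y i - lincomb N g a (x i))) = 0" .
    qed (use u A n in auto)
    also have "- u\<^sup>2 / (2 * (n * (3 * A)\<^sup>2)) = - ln (8 * M)"
      unfolding u(2) using A n by (simp add: field_simps)
    finally show ?thesis using M by (simp add: exp_minus field_simps)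
  qed
  have "(\<Sum>k\<in>{..<M} \<times> UNIV. measure_pmf.prob P (bad k)) \<le> (\<Sum>k\<in>{..<M} \<times> (UNIV::bool set). 1 / (4 * real M))"
    using bad_prob by (intro sum_mono) auto
  also have "\<dots> < 1" using M by (simp add: card_UNIV_bool)
  finally obtain \<omega> where \<omega>: "\<omega> \<in> set_pmf P" "\<And>k. k \<in> {..<M} \<times> UNIV \<Longrightarrow> \<omega> \<notin> bad k"
    using pmf_union_bound[of "{..<M} \<times> UNIV" P bad] by auto
  have \<omega>Y: "\<forall>l<n. \<omega> l \<in> Y"
    using \<omega>(1) set_Pi_pmf_subset'[of "{..<n}" None "\<lambda>_. q"] q(1) by (auto simp: P_def PiE_dflt_def)
  have "cmod (lincomb N g a (x i) - lincomb N g (\<lambda>j. (\<Sum>l<n. atom (\<omega> l) j) / n) (x i)) \<le> \<rho>"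
    if i: "i < M" for i
  proof -
    define Z where "Z = (\<Sum>l<n. L (\<omega> l) i - lincomb N g a (x i))"
    have "\<bar>pr b Z\<bar> \<le> u" for b
      using \<omega>(2)[of "(i, b)"] i by (simp add: bad_def Z_def pr_sum)
    from this[of True] this[of False] have Z: "cmod Z \<le> 2 * u"
      using cmod_le[of Z] by (simp add: pr_def)
    have "lincomb N g (\<lambda>j. (\<Sum>l<n. atom (\<omega> l) j) / n) (x i) = (\<Sum>l<n. L (\<omega> l) i) / n"
      unfolding lincomb_def L_def sum_divide_distrib sum_distrib_right
      by (subst sum.swap) simp
    then have "lincomb N g a (x i) - lincomb N g (\<lambda>j. (\<Sum>l<n. atom (\<omega> l) j) / n) (x i) = - Z / n"
      using n by (simp add: Z_def sum_subtractf field_simps)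
    then have "cmod (lincomb N g a (x i) - lincomb N g (\<lambda>j. (\<Sum>l<n. atom (\<omega> l) j) / n) (x i)) = cmod Z / n"
      by (simp add: norm_divide)
    also have "\<dots> \<le> 2 * u / n" using Z by (simp add: divide_right_mono)
    also have "\<dots> \<le> \<rho>"
    proof (rule power2_le_imp_le)
      have "(2 * u / n)\<^sup>2 = 72 * A\<^sup>2 * ln (8 * real M) / n"
        unfolding power_divide power_mult_distrib u(2) using n by (simp add: field_simps power2_eq_square)
      also have "\<dots> \<le> \<rho>\<^sup>2" using large n by (simp add: field_simps)
      finally show "(2 * u / n)\<^sup>2 \<le> \<rho>\<^sup>2" .
    qed (use \<rho> in simp)
    finally show ?thesis .
  qed
  then show ?thesis using \<omega>Y unfolding Y_def by blast
qed

text \<open>There are at most \<open>4 N + 1\<close> atoms, hence few averages of \<open>n\<close> of them; these form the net.\<close>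
lemma maurey_net:
  fixes g :: "nat \<Rightarrow> 'a \<Rightarrow> complex" and x :: "nat \<Rightarrow> 'a"
  assumes G: "\<And>i j. i < M \<Longrightarrow> j \<in> {1..N} \<Longrightarrow> cmod (g j (x i)) \<le> 1"
    and M: "1 \<le> M" and A: "0 < A" and \<rho>: "0 < \<rho>" and n: "1 \<le> n"
    and large: "72 * A\<^sup>2 * ln (8 * real M) \<le> \<rho>\<^sup>2 * real n"
  obtains Q where "finite Q" "card Q \<le> (4 * N + 1) ^ n"
    "\<And>a. l1 N a \<le> A \<Longrightarrow> \<exists>q\<in>Q. \<forall>i<M. cmod (lincomb N g a (x i) - lincomb N g q (x i)) \<le> \<rho>"
proof -
  define D where "D = {1, -1, \<i>, -\<i>}"
  define Y where "Y = insert None (Some ` (D \<times> {1..N}))"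
  define atom :: "(complex \<times> nat) option \<Rightarrow> nat \<Rightarrow> complex"
    where "atom = (\<lambda>y l. case y of None \<Rightarrow> 0 | Some (d, j) \<Rightarrow> if l = j then of_real (2 * A) * d else 0)"
  define avg :: "(nat \<Rightarrow> (complex \<times> nat) option) \<Rightarrow> nat \<Rightarrow> complex"
    where "avg = (\<lambda>\<omega> j. (\<Sum>l<n. atom (\<omega> l) j) / n)"
  have finY: "finite Y" by (simp add: Y_def D_def)
  have "card Y \<le> Suc (card (D \<times> {1..N}))"
    unfolding Y_def using card_insert_le_m1 card_image_le[of "D \<times> {1..N}" Some]
    by (simp add: D_def card_insert_if image_iff)
  also have "card (D \<times> {1..N}) \<le> 4 * N"
    unfolding card_cartesian_product D_def
    by (intro mult_mono) (auto simp: card_insert_if)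
  finally have cardY: "card Y \<le> 4 * N + 1" by simp
  show thesis
  proof (rule that[of "avg ` ({..<n} \<rightarrow>\<^sub>E Y)"])
    show "finite (avg ` ({..<n} \<rightarrow>\<^sub>E Y))"
      using finY by (intro finite_imageI finite_PiE) auto
    have "card (avg ` ({..<n} \<rightarrow>\<^sub>E Y)) \<le> card ({..<n} \<rightarrow>\<^sub>E Y)"
      using finY by (intro card_image_le finite_PiE) auto
    also have "\<dots> = card Y ^ n" by (simp add: card_PiE)
    also have "\<dots> \<le> (4 * N + 1) ^ n" using cardY by (intro power_mono) auto
    finally show "card (avg ` ({..<n} \<rightarrow>\<^sub>E Y)) \<le> (4 * N + 1) ^ n" .
    fix a assume a: "l1 N a \<le> A"
    have "\<exists>\<omega>. (\<forall>l<n. \<omega> l \<in> Y) \<and>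
      (\<forall>i<M. cmod (lincomb N g a (x i) - lincomb N g (avg \<omega>) (x i)) \<le> \<rho>)"
      unfolding Y_def D_def avg_def atom_def
      by (rule maurey_average[where g = g and x = x, OF G M A \<rho> n large a])
    then obtain \<omega> where \<omega>: "\<forall>l<n. \<omega> l \<in> Y"
      "\<forall>i<M. cmod (lincomb N g a (x i) - lincomb N g (avg \<omega>) (x i)) \<le> \<rho>"
      by blast
    have "avg (restrict \<omega> {..<n}) = avg \<omega>" by (simp add: avg_def fun_eq_iff)
    moreover have "restrict \<omega> {..<n} \<in> {..<n} \<rightarrow>\<^sub>E Y" using \<omega>(1) by auto
    ultimately have "avg \<omega> \<in> avg ` ({..<n} \<rightarrow>\<^sub>E Y)" by (metis image_eqI)
    then show "\<exists>q\<in>avg ` ({..<n} \<rightarrow>\<^sub>E Y). \<forall>i<M. cmod (lincomb N g a (x i) - lincomb N g q (x i)) \<le> \<rho>"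
      using \<omega>(2) by blast
  qed
qed

section \<open>Pairwise random selection\<close>

definition coin_flips :: "nat \<Rightarrow> (nat \<Rightarrow> bool) pmf" where
  "coin_flips n = Pi_pmf {..<n} False (\<lambda>_. pmf_of_set UNIV)"

text \<open>
  The flip \<open>\<omega> i\<close> decides whether point \<open>i\<close> or point \<open>i + n\<close> is kept. Twice the sum of \<open>h\<close> over the
  kept points exceeds its sum over all \<open>2 n\<close> points by exactly this quantity.
\<close>
definition signed_sum :: "nat \<Rightarrow> (nat \<Rightarrow> bool) \<Rightarrow> (nat \<Rightarrow> real) \<Rightarrow> real" where
  "signed_sum n \<omega> h = (\<Sum>i<n. (if \<omega> i then 1 else - 1) * (h i - h (i + n)))"

lemma signed_sum_add: "signed_sum n \<omega> (\<lambda>i. h i + h' i) = signed_sum n \<omega> h + signed_sum n \<omega> h'"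
  by (simp add: signed_sum_def sum.distrib[symmetric] algebra_simps)

lemma signed_sum_sum:
  "signed_sum n \<omega> (\<lambda>i. \<Sum>k\<in>S. h k i) = (\<Sum>k\<in>S. signed_sum n \<omega> (h k))"
  unfolding signed_sum_def sum_subtractf[symmetric] sum_distrib_left by (rule sum.swap)

lemma sum_lessThan_double:
  fixes h :: "nat \<Rightarrow> 'b::comm_monoid_add"
  shows "(\<Sum>i<2*n. h i) = (\<Sum>i<n. h i + h (i + n))"
proof -
  have "(\<Sum>i<2*n. h i) = (\<Sum>i<n. h i) + (\<Sum>i=n..<n+n. h i)"
    using sum.atLeastLessThan_concat[of 0 n "n + n" h] by (simp add: atLeast0LessThan mult_2)
  also have "(\<Sum>i=n..<n+n. h i) = (\<Sum>i<n. h (i + n))"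
    using sum.shift_bounds_nat_ivl[of h 0 n n] by (simp add: atLeast0LessThan)
  finally show ?thesis by (simp add: sum.distrib)
qed

lemma abs_signed_sum_le: "\<bar>signed_sum n \<omega> h\<bar> \<le> (\<Sum>i<2*n. \<bar>h i\<bar>)"
proof -
  have "\<bar>signed_sum n \<omega> h\<bar> \<le> (\<Sum>i<n. \<bar>(if \<omega> i then 1 else - 1) * (h i - h (i + n))\<bar>)"
    unfolding signed_sum_def by (rule sum_abs)
  also have "\<dots> \<le> (\<Sum>i<n. \<bar>h i\<bar> + \<bar>h (i + n)\<bar>)"
    by (intro sum_mono) (auto simp: abs_mult)
  finally show ?thesis by (simp add: sum_lessThan_double)
qed

lemma prob_signed_sum_ge:
  assumes var: "2 * (\<Sum>i<2*n. (h i)\<^sup>2) \<le> \<sigma>2" and \<sigma>2: "0 < \<sigma>2" and u: "0 < u"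
  shows "measure_pmf.prob (coin_flips n) {\<omega>. u \<le> \<bar>signed_sum n \<omega> h\<bar>} \<le> 2 * exp (- u\<^sup>2 / (2 * \<sigma>2))"
  unfolding coin_flips_def signed_sum_def
proof (rule prob_Pi_pmf_abs_sum_ge[where c = "\<lambda>i. \<bar>h i - h (i + n)\<bar>"])
  have "(\<Sum>i<n. \<bar>h i - h (i + n)\<bar>\<^sup>2) \<le> (\<Sum>i<n. 2 * ((h i)\<^sup>2 + (h (i + n))\<^sup>2))"
  proof (rule sum_mono)
    fix i
    have "0 \<le> (h i + h (i + n))\<^sup>2" by simp
    then show "\<bar>h i - h (i + n)\<bar>\<^sup>2 \<le> 2 * ((h i)\<^sup>2 + (h (i + n))\<^sup>2)"
      by (simp add: power2_eq_square algebra_simps)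
  qed
  also have "\<dots> = 2 * (\<Sum>i<2*n. (h i)\<^sup>2)"
    by (simp add: sum_lessThan_double sum_distrib_left)
  finally show "(\<Sum>i<n. \<bar>h i - h (i + n)\<bar>\<^sup>2) \<le> \<sigma>2" using var by simp
  show "measure_pmf.expectation (pmf_of_set UNIV) (\<lambda>b. (if b then 1 else - 1) * (h i - h (i + n))) = 0" for i
    by (subst integral_pmf_of_set) (auto simp: UNIV_bool)
qed (use \<sigma>2 u in \<open>auto simp: abs_mult\<close>)

section \<open>Nets and chaining\<close>

text \<open>
  The unit ball is abstracted to a set \<open>B\<close> of coefficient vectors. Its geometry enters only through
  the last assumption: vectors whose functions differ by at most \<open>t\<close> at all points are close in
  \<open>\<ell>\<^sub>1\<close>. For the exponent \<open>p\<close> on \<open>v\<close>-sparse vectors this combines the Riesz condition for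
  \<open>2v\<close>-sparse vectors with interpolation; for the exponent \<open>2\<close> the factor \<open>t powr (2 - p)\<close> is \<open>1\<close> and the
  Riesz condition for \<open>2v\<close>-sparse vectors is enough also on the \<open>2v\<close>-sparse vectors themselves.
\<close>
context
  fixes p W :: real and M N :: nat and g :: "nat \<Rightarrow> 'a \<Rightarrow> complex" and x :: "nat \<Rightarrow> 'a"
    and B :: "(nat \<Rightarrow> complex) set"
  assumes p: "0 < p" "p \<le> 2" and W: "0 < W" and M: "1 \<le> M" and N: "1 \<le> N"
    and g_le: "\<And>i j. i < M \<Longrightarrow> j \<in> {1..N} \<Longrightarrow> cmod (g j (x i)) \<le> 1"
    and zero_in: "(\<lambda>_. 0) \<in> B"
    and unit: "\<And>a. a \<in> B \<Longrightarrow> (\<Sum>i<M. cmod (lincomb N g a (x i)) powr p) \<le> M"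
    and l1_diff: "\<And>a b t. a \<in> B \<Longrightarrow> b \<in> B \<Longrightarrow> 0 < t \<Longrightarrow>
        (\<And>i. i < M \<Longrightarrow> cmod (lincomb N g a (x i) - lincomb N g b (x i)) \<le> t) \<Longrightarrow>
        (l1 N (\<lambda>j. a j - b j))\<^sup>2 \<le> W * t powr (2 - p)"
begin

text \<open>
  The largest value \<open>t\<close> satisfies \<open>t\<^sup>2 \<le> (l1 N a)\<^sup>2 \<le> W t powr (2 - p)\<close>, by comparing \<open>a\<close> with \<open>0\<close>.
  So \<open>B\<close> has radius \<open>W powr (1/p)\<close>, which is where the chain starts.
\<close>
lemma sup_le_of_unit:
  assumes a: "a \<in> B" and i: "i < M"
  shows "cmod (lincomb N g a (x i)) \<le> W powr (1 / p)"
proof -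
  define t where "t = Max ((\<lambda>i. cmod (lincomb N g a (x i))) ` {..<M})"
  have ne: "(\<lambda>i. cmod (lincomb N g a (x i))) ` {..<M} \<noteq> {}" using M by (auto simp: lessThan_empty_iff)
  have le: "cmod (lincomb N g a (x i)) \<le> t" if "i < M" for i
    unfolding t_def using that by (intro Max_ge) auto
  obtain i0 where i0: "i0 < M" "t = cmod (lincomb N g a (x i0))"
    using Max_in[OF _ ne] by (auto simp: t_def)
  show ?thesis
  proof (cases "t = 0")
    case True
    then show ?thesis using le[OF i] by (smt (verit) powr_ge_zero)
  next
    case False
    then have t: "0 < t" using i0 by simp
    have "(l1 N a)\<^sup>2 \<le> W * t powr (2 - p)"
      using l1_diff[OF a zero_in t] le by (simp add: lincomb_def)
    moreover have "t \<le> l1 N a"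
      unfolding i0(2) using g_le[OF i0(1)] by (intro cmod_lincomb_le_l1)
    then have "t\<^sup>2 \<le> (l1 N a)\<^sup>2" using t by (intro power_mono) auto
    moreover have "t\<^sup>2 = t powr p * t powr (2 - p)"
      using t by (simp add: powr_add[symmetric])
    ultimately have "t powr p * t powr (2 - p) \<le> W * t powr (2 - p)" by simp
    then have "t powr p \<le> W" using t by simp
    then have "(t powr p) powr (1 / p) \<le> W powr (1 / p)"
      using p by (intro powr_mono2) auto
    then have "t \<le> W powr (1 / p)" using t p by (simp add: powr_powr)
    then show ?thesis using le[OF i] by simp
  qed
qed

definition radius :: "nat \<Rightarrow> real" where "radius k = W powr (1 / p) / 2 ^ k"

text \<open>
  The coefficient of \<open>2 powr (k p)\<close> in the bound on the logarithm of the size of the \<open>k\<close>-th net. The factor \<open>2400 / p\<close> makes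
  its product with \<open>2 powr p - 1\<close>, which is at least \<open>p / 2\<close>, dominate the cost of refining a net once.
\<close>
definition log_net_size :: real where
  "log_net_size = 2400 / p * ln (8 * real M) * ln (4 * real N + 1)"

lemma radius_pos: "0 < radius k"
  using W by (simp add: radius_def)

lemma radius_powr: "radius k powr p = W / 2 powr (k * p)"
  using W p by (simp add: radius_def powr_divide powr_powr powr_realpow[symmetric])

lemma ln_sample_ge: "1 \<le> ln (8 * real M)"
proof -
  have "exp 1 \<le> 8 * real M" using M exp_le by (simp add: order_trans[of _ 3])
  then show ?thesis using M by (subst ln_ge_iff) auto
qed

lemma ln_dict_ge: "1 \<le> ln (4 * real N + 1)"
proof -
  have "exp 1 \<le> 4 * real N + 1" using N exp_le by (simp add: order_trans[of _ 3])
  then show ?thesis by (subst ln_ge_iff) auto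
qed

lemma log_net_size_p: "log_net_size * p = 2400 * (ln (8 * real M) * ln (4 * real N + 1))"
  using p by (simp add: log_net_size_def)

lemma log_net_size_pos: "0 < log_net_size"
  unfolding log_net_size_def using p N ln_sample_ge ln_dict_ge
  by (intro mult_pos_pos divide_pos_pos) auto

text \<open>
  The net at scale \<open>k + 1\<close> refines the one at scale \<open>k\<close>: the difference of \<open>a\<close> and its nearest net point
  has a small \<open>\<ell>\<^sub>1\<close>-norm, because the two functions are already within \<open>radius k\<close> of each other, and
  Maurey's net approximates this difference. Since \<open>W / radius k powr p = 2 powr (k p)\<close>, the cost of the
  refinement grows geometrically, and the last refinement dominates the total.
\<close>
lemma nets:
  "\<exists>T. finite T \<and> T \<subseteq> B \<and> (k = 0 \<longrightarrow> T = {\<lambda>_. 0}) \<and> card T \<le> exp (log_net_size * 2 powr (k * p)) \<and>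
     (\<forall>a\<in>B. \<exists>b\<in>T. \<forall>i<M. cmod (lincomb N g a (x i) - lincomb N g b (x i)) \<le> radius k)"
proof (induction k)
  case 0
  show ?case
    using zero_in sup_le_of_unit log_net_size_pos
    by (intro exI[of _ "{\<lambda>_. 0}"]) (auto simp: radius_def lincomb_def)
next
  case (Suc k)
  then obtain T where T: "finite T" "T \<subseteq> B" "card T \<le> exp (log_net_size * 2 powr (k * p))"
    "\<forall>a\<in>B. \<exists>b\<in>T. \<forall>i<M. cmod (lincomb N g a (x i) - lincomb N g b (x i)) \<le> radius k"
    by blast
  define t where "t = radius k"
  have t: "0 < t" "t powr p = W / 2 powr (k * p)"
    by (simp_all add: t_def radius_pos radius_powr)
  define A where "A = sqrt (W * t powr (2 - p))"
  have A: "0 < A" "A\<^sup>2 = W * t powr (2 - p)" using W t by (auto simp: A_def)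
  define z where "z = 2 powr (k * p) * ln (8 * real M)"
  have pow1: "1 \<le> 2 powr (k * p)" using p by (simp add: ge_one_powr_ge_zero)
  have z1: "1 \<le> z" unfolding z_def using mult_mono[OF pow1 ln_sample_ge] by simp
  define n where "n = nat \<lceil>1152 * z\<rceil>"
  have n: "1152 * z \<le> n" "n \<le> 1200 * z" "1 \<le> n" using z1 unfolding n_def by linarith+
  have "72 * A\<^sup>2 * ln (8 * real M) \<le> (t / 4)\<^sup>2 * n"
  proof -
    have "t\<^sup>2 = t powr (2 - p) * (W / 2 powr (k * p))"
      using t by (simp add: powr_add[symmetric] flip: t(2))
    then have "(t / 4)\<^sup>2 * n = t powr (2 - p) * (W / 2 powr (k * p)) / 16 * n"
      by (simp add: power_divide)
    also have "\<dots> \<ge> t powr (2 - p) * (W / 2 powr (k * p)) / 16 * (1152 * z)"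
      using n W by (intro mult_left_mono) auto
    finally show ?thesis unfolding A(2) z_def by (simp add: mult_ac)
  qed
  then obtain Q where Q: "finite Q" "card Q \<le> (4 * N + 1) ^ n"
    "\<And>a. l1 N a \<le> A \<Longrightarrow> \<exists>q\<in>Q. \<forall>i<M. cmod (lincomb N g a (x i) - lincomb N g q (x i)) \<le> t / 4"
    using maurey_net[of M N g x A "t / 4" n] g_le M A t n by auto
  \<comment> \<open>The points \<open>b + q\<close> need not lie in \<open>B\<close>. Replacing them by elements of \<open>B\<close> doubles the
    error \<open>t / 4\<close>, which is why Maurey's radius is half of the next radius.\<close>
  define near where "near = (\<lambda>b q f. f \<in> B \<and>
    (\<forall>i<M. cmod (lincomb N g f (x i) - lincomb N g b (x i) - lincomb N g q (x i)) \<le> t / 4))"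
  define T' where "T' = (\<lambda>(b, q). SOME f. near b q f) ` {(b, q) \<in> T \<times> Q. \<exists>f. near b q f}"
  have some: "near b q (SOME f. near b q f)" if "near b q f" for b q f
    using that by (rule someI[of "near b q"])
  have fin: "finite {(b, q) \<in> T \<times> Q. \<exists>f. near b q f}"
    using T(1) Q(1) by (auto intro: finite_subset[OF _ finite_cartesian_product[OF T(1) Q(1)]])
  have "T' \<subseteq> B" using some by (auto simp: T'_def near_def)
  moreover have "finite T'" using fin by (simp add: T'_def)
  moreover have "card T' \<le> exp (log_net_size * 2 powr (Suc k * p))"
  proof -
    have "card T' \<le> card {(b, q) \<in> T \<times> Q. \<exists>f. near b q f}"
      unfolding T'_def by (rule card_image_le[OF fin])
    also have "\<dots> \<le> card (T \<times> Q)" using T(1) Q(1) by (intro card_mono) auto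
    finally have "real (card T') \<le> real (card T) * real (card Q)"
      by (simp add: card_cartesian_product flip: of_nat_mult)
    also have "\<dots> \<le> exp (log_net_size * 2 powr (k * p)) * real ((4 * N + 1) ^ n)"
      using T(3) Q(2) by (intro mult_mono) (auto simp only: of_nat_le_iff of_nat_0_le_iff exp_ge_zero)
    also have "real ((4 * N + 1) ^ n) = exp (n * ln (4 * real N + 1))"
      using exp_of_nat_mult[of n "ln (4 * real N + 1)"] by (simp add: add.commute)
    also have "\<dots> \<le> exp (1200 * z * ln (4 * real N + 1))"
      using n(2) ln_dict_ge by (simp add: mult_right_mono)
    also have "exp (log_net_size * 2 powr (k * p)) * \<dots> = exp (log_net_size * 2 powr (k * p) + 1200 * z * ln (4 * real N + 1))"
      by (simp add: exp_add)
    also have "1200 * z * ln (4 * real N + 1) = 2 powr (k * p) * (log_net_size * p / 2)"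
      unfolding log_net_size_p z_def by simp
    also have "log_net_size * 2 powr (k * p) + 2 powr (k * p) * (log_net_size * p / 2)
        = log_net_size * 2 powr (k * p) * (1 + p / 2)"
      by (simp add: algebra_simps)
    also have "\<dots> \<le> log_net_size * 2 powr (k * p) * 2 powr p"
      using log_net_size_pos p by (intro mult_left_mono one_add_half_le_two_powr) auto
    also have "\<dots> = log_net_size * 2 powr (Suc k * p)"
      by (simp add: powr_add[symmetric] algebra_simps)
    finally show ?thesis by simp
  qed
  moreover have "\<exists>f\<in>T'. \<forall>i<M. cmod (lincomb N g a (x i) - lincomb N g f (x i)) \<le> radius (Suc k)"
    if a: "a \<in> B" for a
  proof -
    obtain b where b: "b \<in> T" "\<forall>i<M. cmod (lincomb N g a (x i) - lincomb N g b (x i)) \<le> t"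
      using T(4) a t_def by blast
    have "(l1 N (\<lambda>j. a j - b j))\<^sup>2 \<le> A\<^sup>2"
      unfolding A(2) using b T(2) a t by (intro l1_diff) auto
    then have "l1 N (\<lambda>j. a j - b j) \<le> A" using A(1) by (simp add: power2_le_iff_abs_le)
    then obtain q where q: "q \<in> Q"
      "\<forall>i<M. cmod (lincomb N g (\<lambda>j. a j - b j) (x i) - lincomb N g q (x i)) \<le> t / 4"
      using Q(3) by blast
    then have na: "near b q a" using a by (simp add: near_def lincomb_diff)
    define f where "f = (SOME f. near b q f)"
    have nf: "near b q f" unfolding f_def using na by (rule some)
    have "cmod (lincomb N g a (x i) - lincomb N g f (x i)) \<le> radius (Suc k)" if "i < M" for i
    proof -
      let ?c = "lincomb N g b (x i) + lincomb N g q (x i)"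
      have "cmod (lincomb N g a (x i) - lincomb N g f (x i))
          \<le> cmod (lincomb N g a (x i) - ?c) + cmod (lincomb N g f (x i) - ?c)"
        using norm_triangle_ineq4[of "lincomb N g a (x i) - ?c" "lincomb N g f (x i) - ?c"] by simp
      also have "\<dots> \<le> t / 4 + t / 4"
        using na nf that by (intro add_mono) (auto simp: near_def diff_diff_eq)
      finally show ?thesis by (simp add: t_def radius_def)
    qed
    moreover have "f \<in> T'" using b q na unfolding T'_def f_def by force
    ultimately show ?thesis by blast
  qed
  ultimately show ?case by (intro exI[of _ T']) auto
qed

lemma link_variance:
  assumes ab: "a \<in> B" "b \<in> B"
    and close: "\<And>i. i < M \<Longrightarrow> cmod (lincomb N g a (x i) - lincomb N g b (x i)) \<le> t"
  defines "h \<equiv> (\<lambda>i. cmod (lincomb N g a (x i)) powr p - cmod (lincomb N g b (x i)) powr p)"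
  shows "(\<Sum>i<M. (h i)\<^sup>2) \<le> 4 * M * t powr p"
proof -
  have "(\<Sum>i<M. (h i)\<^sup>2) \<le> (\<Sum>i<M. 2 * t powr p *
      (cmod (lincomb N g a (x i)) powr p + cmod (lincomb N g b (x i)) powr p))"
    unfolding h_def
  proof (rule sum_mono)
    fix i assume "i \<in> {..<M}"
    then have "\<bar>cmod (lincomb N g a (x i)) - cmod (lincomb N g b (x i))\<bar> \<le> t"
      using close[of i] norm_triangle_ineq3 order_trans by (fastforce simp: lessThan_iff)
    then show "(cmod (lincomb N g a (x i)) powr p - cmod (lincomb N g b (x i)) powr p)\<^sup>2
      \<le> 2 * t powr p * (cmod (lincomb N g a (x i)) powr p + cmod (lincomb N g b (x i)) powr p)"
      by (intro powr_diff_squared_le p) auto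
  qed
  also have "\<dots> = 2 * t powr p * ((\<Sum>i<M. cmod (lincomb N g a (x i)) powr p)
      + (\<Sum>i<M. cmod (lincomb N g b (x i)) powr p))"
    unfolding sum_distrib_left[symmetric] sum.distrib ..
  also have "\<dots> \<le> 2 * t powr p * (M + M)"
    using unit[OF ab(1)] unit[OF ab(2)] by (intro mult_left_mono add_mono) auto
  finally show ?thesis by (simp add: mult_ac)
qed

text \<open>
  The squared Euclidean norm of a link is of order \<open>M W 2 powr (- k p)\<close>, while the logarithm of the number
  of links is of order \<open>log_net_size * 2 powr (k p)\<close>. In the product of the two, which governs the
  threshold, \<open>k\<close> cancels.
\<close>
lemma prob_link_ge:
  assumes M2: "M = 2 * n" and ab: "a \<in> B" "b \<in> B"
    and close: "\<And>i. i < M \<Longrightarrow> cmod (lincomb N g a (x i) - lincomb N g b (x i)) \<le> 2 * radius k"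
  defines "h \<equiv> (\<lambda>i. cmod (lincomb N g a (x i)) powr p - cmod (lincomb N g b (x i)) powr p)"
  shows "measure_pmf.prob (coin_flips n) {\<omega>. sqrt (384 * M * W * log_net_size) \<le> \<bar>signed_sum n \<omega> h\<bar>}
    \<le> 2 * exp (- 6 * log_net_size * 2 powr (k * p))"
proof -
  define u where "u = sqrt (384 * M * W * log_net_size)"
  have u: "0 < u" "u\<^sup>2 = 384 * M * W * log_net_size"
    using M W log_net_size_pos by (auto simp: u_def)
  have "2 powr p \<le> 2 powr 2" using p by (intro powr_mono) auto
  then have r: "(2 * radius k) powr p \<le> 4 * (W / 2 powr (k * p))"
    using W unfolding powr_mult radius_powr by (intro mult_right_mono) auto
  have "measure_pmf.prob (coin_flips n) {\<omega>. u \<le> \<bar>signed_sum n \<omega> h\<bar>}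
      \<le> 2 * exp (- u\<^sup>2 / (2 * (32 * M * (W / 2 powr (k * p)))))"
  proof (rule prob_signed_sum_ge)
    have "(\<Sum>i<2*n. (h i)\<^sup>2) \<le> 4 * M * (2 * radius k) powr p"
      using link_variance[OF ab close] unfolding h_def M2 by simp
    also have "\<dots> \<le> 4 * M * (4 * (W / 2 powr (k * p)))"
      using r by (intro mult_left_mono) auto
    finally show "2 * (\<Sum>i<2*n. (h i)\<^sup>2) \<le> 32 * M * (W / 2 powr (k * p))" by simp
  qed (use u M W in auto)
  also have "- u\<^sup>2 / (2 * (32 * M * (W / 2 powr (k * p)))) = - 6 * log_net_size * 2 powr (k * p)"
    unfolding u(2) using M W by (simp add: field_simps)
  finally show ?thesis by (simp add: u_def)
qed

lemma exp_log_net_size_le: "exp (- log_net_size * 2 powr (k * p)) \<le> (1 / 2) ^ (k + 3)"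
proof -
  have LL: "1 \<le> ln (8 * real M) * ln (4 * real N + 1)"
    using mult_mono[OF ln_sample_ge ln_dict_ge] ln_sample_ge by simp
  have "real k + 3 \<le> (2400 * (ln (8 * real M) * ln (4 * real N + 1))) / 2 + k * ((2400 * (ln (8 * real M) * ln (4 * real N + 1))) / 2)"
    using LL mult_left_mono[OF LL, of "real k"] by simp
  also have "\<dots> = log_net_size * (p / 2) + log_net_size * (k * (p / 2))"
    by (simp add: log_net_size_p[symmetric])
  also have "\<dots> \<le> log_net_size * 1 + log_net_size * (k * (p / 2))"
    using p log_net_size_pos by (intro add_mono mult_left_mono) auto
  also have "\<dots> = log_net_size * (1 + (k * p) / 2)" by (simp add: algebra_simps)
  also have "\<dots> \<le> log_net_size * 2 powr (k * p)"
    using p log_net_size_pos by (intro mult_left_mono one_add_half_le_two_powr) auto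
  finally have *: "real (k + 3) \<le> log_net_size * 2 powr (k * p)" by simp
  have e: "exp (- 1) \<le> (1 / 2 :: real)"
    using exp_ge_add_one_self[of 1] by (simp add: exp_minus field_simps)
  have "exp (- log_net_size * 2 powr (k * p)) \<le> exp (real (k + 3) * (- 1))"
    using * by simp
  also have "\<dots> = exp (- 1) ^ (k + 3)" by (rule exp_of_nat_mult)
  also have "\<dots> \<le> (1 / 2) ^ (k + 3)" using e by (intro power_mono) auto
  finally show ?thesis .
qed

text \<open>
  Chaining: \<open>|f|\<^sup>p\<close> is telescoped along the nearest net points at scales \<open>0, \<dots>, R\<close>. Each of the \<open>R\<close> links
  is controlled with large probability, uniformly over the nets. The remainder after scale \<open>R\<close> is
  bounded for every choice of signs; the hypotheses on \<open>R\<close> and \<open>M\<close> make the links and the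
  remainder contribute at most \<open>\<delta> M / 2\<close> each.
\<close>
lemma chaining:
  fixes \<delta> :: real and n R :: nat
  assumes M2: "M = 2 * n" and \<delta>: "0 < \<delta>"
    and R: "16 * W \<le> \<delta>\<^sup>2 * 2 powr (R * p)"
    and large: "1536 * (real R)\<^sup>2 * W * (2400 / p * ln (8 * real M) * ln (4 * real N + 1)) \<le> M * \<delta>\<^sup>2"
  shows "measure_pmf.prob (coin_flips n)
    {\<omega>. \<exists>a\<in>B. \<delta> * M < \<bar>signed_sum n \<omega> (\<lambda>i. cmod (lincomb N g a (x i)) powr p)\<bar>} < 1 / 2"
proof -
  define \<phi> where "\<phi> = (\<lambda>a i. cmod (lincomb N g a (x i)) powr p)"
  obtain T :: "nat \<Rightarrow> (nat \<Rightarrow> complex) set" where T: "\<And>k. finite (T k)" "\<And>k. T k \<subseteq> B" "T 0 = {\<lambda>_. 0}"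
    "\<And>k. card (T k) \<le> exp (log_net_size * 2 powr (k * p))"
    "\<And>k a. a \<in> B \<Longrightarrow> \<exists>b\<in>T k. \<forall>i<M. cmod (lincomb N g a (x i) - lincomb N g b (x i)) \<le> radius k"
    using nets by metis
  define near where "near = (\<lambda>k a. SOME b. b \<in> T k \<and>
    (\<forall>i<M. cmod (lincomb N g a (x i) - lincomb N g b (x i)) \<le> radius k))"
  have near: "near k a \<in> T k \<and>
    (\<forall>i<M. cmod (lincomb N g a (x i) - lincomb N g (near k a) (x i)) \<le> radius k)" if "a \<in> B" for k a
  proof -
    from T(5)[OF that, of k] have "\<exists>b. b \<in> T k \<and>
        (\<forall>i<M. cmod (lincomb N g a (x i) - lincomb N g b (x i)) \<le> radius k)" by blast
    then show ?thesis unfolding near_def by (rule someI_ex)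
  qed
  define links where "links = (\<lambda>k. {(a, b) \<in> T (Suc k) \<times> T k.
    \<forall>i<M. cmod (lincomb N g a (x i) - lincomb N g b (x i)) \<le> 2 * radius k})"
  have near_link: "(near (Suc k) a, near k a) \<in> links k" if a: "a \<in> B" for k a
  proof -
    have "cmod (lincomb N g (near (Suc k) a) (x i) - lincomb N g (near k a) (x i)) \<le> 2 * radius k"
      if i: "i < M" for i
    proof -
      have 1: "cmod (lincomb N g a (x i) - lincomb N g (near (Suc k) a) (x i)) \<le> radius (Suc k)"
        and 2: "cmod (lincomb N g a (x i) - lincomb N g (near k a) (x i)) \<le> radius k"
        using near[OF a] i by auto
      have "cmod (lincomb N g (near (Suc k) a) (x i) - lincomb N g (near k a) (x i))
          \<le> cmod (lincomb N g a (x i) - lincomb N g (near k a) (x i))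
            + cmod (lincomb N g a (x i) - lincomb N g (near (Suc k) a) (x i))"
        using norm_triangle_ineq4[of "lincomb N g a (x i) - lincomb N g (near k a) (x i)"
            "lincomb N g a (x i) - lincomb N g (near (Suc k) a) (x i)"] by simp
      also have "\<dots> \<le> radius k + radius (Suc k)" using 1 2 by simp
      also have "\<dots> \<le> 2 * radius k" using radius_pos[of k] by (simp add: radius_def)
      finally show ?thesis .
    qed
    then show ?thesis using near[OF a] by (auto simp: links_def)
  qed
  have fin_links: "finite (links k)" for k
    unfolding links_def
    by (rule finite_subset[OF _ finite_cartesian_product[OF T(1) T(1)]]) auto
  have card_links: "card (links k) \<le> exp (5 * log_net_size * 2 powr (k * p))" for k
  proof -
    have "card (links k) \<le> card (T (Suc k) \<times> T k)"
      unfolding links_def using T(1) by (intro card_mono) auto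
    then have "real (card (links k)) \<le> real (card (T (Suc k))) * real (card (T k))"
      by (simp add: card_cartesian_product flip: of_nat_mult)
    also have "\<dots> \<le> exp (log_net_size * 2 powr (Suc k * p)) * exp (log_net_size * 2 powr (k * p))"
      by (intro mult_mono T(4)) auto
    also have "\<dots> = exp (log_net_size * (2 powr (Suc k * p) + 2 powr (k * p)))"
      by (simp add: exp_add distrib_left)
    also have "\<dots> \<le> exp (5 * log_net_size * 2 powr (k * p))"
    proof -
      have "2 powr (Suc k * p) = 2 powr p * 2 powr (k * p)"
        by (simp add: powr_add[symmetric] algebra_simps)
      also have "\<dots> \<le> 2 powr 2 * 2 powr (k * p)"
        using p by (intro mult_right_mono powr_mono) auto
      finally have "2 powr (Suc k * p) + 2 powr (k * p) \<le> 5 * 2 powr (k * p)" by simp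
      from mult_left_mono[OF this, of log_net_size] show ?thesis
        using log_net_size_pos by (simp add: mult_ac)
    qed
    finally show ?thesis .
  qed
  define u where "u = sqrt (384 * M * W * log_net_size)"
  have u: "0 < u" "u\<^sup>2 = 384 * M * W * log_net_size"
    using M W log_net_size_pos by (auto simp: u_def)
  define bad where "bad = (\<lambda>(a, b). {\<omega>. u \<le> \<bar>signed_sum n \<omega> (\<lambda>i. \<phi> a i - \<phi> b i)\<bar>})"
  have bad_links: "measure_pmf.prob (coin_flips n) (\<Union>(bad ` links k)) \<le> (1 / 2) ^ (k + 2)" for k
  proof -
    have "measure_pmf.prob (coin_flips n) (\<Union>(bad ` links k))
        \<le> (\<Sum>l\<in>links k. measure_pmf.prob (coin_flips n) (bad l))"
      using fin_links by (intro measure_pmf.finite_measure_subadditive_finite) auto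
    also have "\<dots> \<le> (\<Sum>l\<in>links k. 2 * exp (- 6 * log_net_size * 2 powr (k * p)))"
    proof (rule sum_mono)
      fix l assume "l \<in> links k"
      then obtain a b where "l = (a, b)" "a \<in> B" "b \<in> B"
        "\<And>i. i < M \<Longrightarrow> cmod (lincomb N g a (x i) - lincomb N g b (x i)) \<le> 2 * radius k"
        using T(2) unfolding links_def by blast
      then show "measure_pmf.prob (coin_flips n) (bad l) \<le> 2 * exp (- 6 * log_net_size * 2 powr (k * p))"
        using prob_link_ge[OF M2, of a b k] by (simp add: bad_def u_def \<phi>_def)
    qed
    also have "\<dots> = card (links k) * (2 * exp (- 6 * log_net_size * 2 powr (k * p)))" by simp
    also have "\<dots> \<le> exp (5 * log_net_size * 2 powr (k * p)) * (2 * exp (- 6 * log_net_size * 2 powr (k * p)))"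
      by (intro mult_right_mono card_links) auto
    also have "\<dots> = 2 * exp (- log_net_size * 2 powr (k * p))"
      by (simp add: exp_add[symmetric] algebra_simps)
    also have "\<dots> \<le> 2 * (1 / 2) ^ (k + 3)" using exp_log_net_size_le[of k] by simp
    also have "\<dots> = (1 / 2) ^ (k + 2)" by (simp add: power_add power3_eq_cube power2_eq_square)
    finally show ?thesis .
  qed
  have "{\<omega>. \<exists>a\<in>B. \<delta> * M < \<bar>signed_sum n \<omega> (\<phi> a)\<bar>} \<subseteq> (\<Union>k<R. \<Union>(bad ` links k))"
  proof (rule ccontr)
    assume "\<not> {\<omega>. \<exists>a\<in>B. \<delta> * M < \<bar>signed_sum n \<omega> (\<phi> a)\<bar>} \<subseteq> (\<Union>k<R. \<Union>(bad ` links k))"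
    then obtain \<omega> a where a: "a \<in> B" "\<delta> * M < \<bar>signed_sum n \<omega> (\<phi> a)\<bar>"
      and good: "\<And>k l. k < R \<Longrightarrow> l \<in> links k \<Longrightarrow> \<omega> \<notin> bad l" by blast
    define \<psi> where "\<psi> = (\<lambda>k. \<phi> (near k a))"
    have "near 0 a = (\<lambda>_. 0)" using near[OF a(1), of 0] T(3) by simp
    then have \<psi>0: "\<psi> 0 = (\<lambda>_. 0)" by (simp add: \<psi>_def \<phi>_def lincomb_def)
    have "\<phi> a = (\<lambda>i. (\<phi> a i - \<psi> R i) + (\<Sum>k<R. \<psi> (Suc k) i - \<psi> k i))"
    proof
      fix i
      show "\<phi> a i = (\<phi> a i - \<psi> R i) + (\<Sum>k<R. \<psi> (Suc k) i - \<psi> k i)"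
        using sum_lessThan_telescope[of "\<lambda>k. \<psi> k i" R] by (simp add: \<psi>0)
    qed
    then have "signed_sum n \<omega> (\<phi> a) = signed_sum n \<omega> (\<lambda>i. \<phi> a i - \<psi> R i)
        + (\<Sum>k<R. signed_sum n \<omega> (\<lambda>i. \<psi> (Suc k) i - \<psi> k i))"
      by (subst signed_sum_sum[symmetric], subst signed_sum_add[symmetric]) (erule arg_cong)
    moreover have "\<bar>\<Sum>k<R. signed_sum n \<omega> (\<lambda>i. \<psi> (Suc k) i - \<psi> k i)\<bar> \<le> R * u"
    proof -
      have "\<bar>\<Sum>k<R. signed_sum n \<omega> (\<lambda>i. \<psi> (Suc k) i - \<psi> k i)\<bar>
          \<le> (\<Sum>k<R. \<bar>signed_sum n \<omega> (\<lambda>i. \<psi> (Suc k) i - \<psi> k i)\<bar>)" by (rule sum_abs)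
      also have "\<dots> \<le> (\<Sum>k<R. u)"
        using good near_link[OF a(1)] by (intro sum_mono) (force simp: bad_def \<psi>_def)
      finally show ?thesis by simp
    qed
    moreover have "R * u \<le> \<delta> * M / 2"
    proof (rule power2_le_imp_le)
      have "(R * u)\<^sup>2 = (1536 * (real R)\<^sup>2 * W * log_net_size) * M / 4"
        unfolding power_mult_distrib u(2) by simp
      also have "\<dots> \<le> (M * \<delta>\<^sup>2) * M / 4"
        using large by (intro divide_right_mono mult_right_mono) (auto simp: log_net_size_def)
      also have "\<dots> = (\<delta> * M / 2)\<^sup>2" by (simp add: power2_eq_square)
      finally show "(R * u)\<^sup>2 \<le> (\<delta> * M / 2)\<^sup>2" .
    qed (use \<delta> in simp)
    moreover have "\<bar>signed_sum n \<omega> (\<lambda>i. \<phi> a i - \<psi> R i)\<bar> \<le> \<delta> * M / 2"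
    proof (rule power2_le_imp_le)
      have "\<bar>signed_sum n \<omega> (\<lambda>i. \<phi> a i - \<psi> R i)\<bar> \<le> (\<Sum>i<M. \<bar>\<phi> a i - \<psi> R i\<bar>)"
        unfolding M2 by (rule abs_signed_sum_le)
      then have "\<bar>signed_sum n \<omega> (\<lambda>i. \<phi> a i - \<psi> R i)\<bar>\<^sup>2 \<le> (\<Sum>i<M. \<bar>\<phi> a i - \<psi> R i\<bar>)\<^sup>2"
        by (intro power_mono) auto
      also have "\<dots> \<le> M * (\<Sum>i<M. (\<phi> a i - \<psi> R i)\<^sup>2)"
        using Cauchy_Schwarz_ineq_sum[of "\<lambda>_. 1" "\<lambda>i. \<bar>\<phi> a i - \<psi> R i\<bar>" "{..<M}"] by simp
      also have "\<dots> \<le> M * (4 * M * radius R powr p)"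
        unfolding \<psi>_def \<phi>_def using near[OF a(1), of R] T(2) a(1)
        by (intro mult_left_mono link_variance) auto
      also have "\<dots> \<le> M * (4 * M * (\<delta>\<^sup>2 / 16))"
        unfolding radius_powr using R by (intro mult_left_mono) (auto simp: field_simps)
      also have "\<dots> = (\<delta> * M / 2)\<^sup>2" by (simp add: power2_eq_square)
      finally show "\<bar>signed_sum n \<omega> (\<lambda>i. \<phi> a i - \<psi> R i)\<bar>\<^sup>2 \<le> (\<delta> * M / 2)\<^sup>2" .
    qed (use \<delta> in simp)
    ultimately show False using a(2) by linarith
  qed
  then have "measure_pmf.prob (coin_flips n) {\<omega>. \<exists>a\<in>B. \<delta> * M < \<bar>signed_sum n \<omega> (\<phi> a)\<bar>}
      \<le> measure_pmf.prob (coin_flips n) (\<Union>k<R. \<Union>(bad ` links k))"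
    by (intro measure_pmf.finite_measure_mono) auto
  also have "\<dots> \<le> (\<Sum>k<R. measure_pmf.prob (coin_flips n) (\<Union>(bad ` links k)))"
    by (intro measure_pmf.finite_measure_subadditive_finite) auto
  also have "\<dots> \<le> (\<Sum>k<R. (1 / 2) ^ (k + 2))" by (intro sum_mono bad_links)
  also have "\<dots> = (1 - (1 / 2) ^ R) / 2"
    by (induction R) (auto simp: power_add field_simps)
  also have "\<dots> < 1 / 2" by simp
  finally show ?thesis by (simp add: \<phi>_def)
qed

end

section \<open>One halving step\<close>

text \<open>Both sides of the inequality are homogeneous of degree \<open>p\<close>, so the unit ball suffices for a cone.\<close>
lemma prob_large_signed_sum_less_half:
  fixes p W \<delta> :: real and M N n R :: nat and g :: "nat \<Rightarrow> 'a \<Rightarrow> complex" and x :: "nat \<Rightarrow> 'a"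
  assumes p: "0 < p" "p \<le> 2" and W: "0 < W" and M: "1 \<le> M" "M = 2 * n" and N: "1 \<le> N"
    and g_le: "\<And>i j. i < M \<Longrightarrow> j \<in> {1..N} \<Longrightarrow> cmod (g j (x i)) \<le> 1"
    and zero_in: "(\<lambda>_. 0) \<in> S" and scale: "\<And>a c. a \<in> S \<Longrightarrow> (\<lambda>j. c * a j) \<in> S"
    and l1_diff: "\<And>a b t. a \<in> S \<Longrightarrow> b \<in> S \<Longrightarrow> 0 < t \<Longrightarrow>
        avg_pow M x p (lincomb N g a) \<le> 1 \<Longrightarrow> avg_pow M x p (lincomb N g b) \<le> 1 \<Longrightarrow>
        (\<And>i. i < M \<Longrightarrow> cmod (lincomb N g a (x i) - lincomb N g b (x i)) \<le> t) \<Longrightarrow>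
        (l1 N (\<lambda>j. a j - b j))\<^sup>2 \<le> W * t powr (2 - p)"
    and \<delta>: "0 < \<delta>" and R: "16 * W \<le> \<delta>\<^sup>2 * 2 powr (R * p)"
    and large: "1536 * (real R)\<^sup>2 * W * (2400 / p * ln (8 * real M) * ln (4 * real N + 1)) \<le> M * \<delta>\<^sup>2"
  shows "measure_pmf.prob (coin_flips n) {\<omega>. \<exists>a\<in>S. \<delta> * M * avg_pow M x p (lincomb N g a)
     < \<bar>signed_sum n \<omega> (\<lambda>i. cmod (lincomb N g a (x i)) powr p)\<bar>} < 1 / 2"
proof -
  define B where "B = {a\<in>S. avg_pow M x p (lincomb N g a) \<le> 1}"
  have sub: "{\<omega>. \<exists>a\<in>S. \<delta> * M * avg_pow M x p (lincomb N g a)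
       < \<bar>signed_sum n \<omega> (\<lambda>i. cmod (lincomb N g a (x i)) powr p)\<bar>}
     \<subseteq> {\<omega>. \<exists>a\<in>B. \<delta> * M < \<bar>signed_sum n \<omega> (\<lambda>i. cmod (lincomb N g a (x i)) powr p)\<bar>}"
  proof safe
    fix \<omega> a assume a: "a \<in> S" and big: "\<delta> * M * avg_pow M x p (lincomb N g a)
       < \<bar>signed_sum n \<omega> (\<lambda>i. cmod (lincomb N g a (x i)) powr p)\<bar>"
    define s where "s = avg_pow M x p (lincomb N g a)"
    have "s \<noteq> 0"
    proof
      assume "s = 0"
      then have "(\<Sum>i<M. cmod (lincomb N g a (x i)) powr p) = 0"
        using M by (auto simp: s_def avg_pow_def)
      then have "\<bar>signed_sum n \<omega> (\<lambda>i. cmod (lincomb N g a (x i)) powr p)\<bar> \<le> 0"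
        using abs_signed_sum_le[of n \<omega> "\<lambda>i. cmod (lincomb N g a (x i)) powr p"] M(2) by simp
      then show False using big \<open>s = 0\<close> by (simp add: s_def)
    qed
    then have s: "0 < s" using avg_pow_nonneg[of M x p "lincomb N g a"] by (simp add: s_def)
    define c where "c = (1 / s) powr (1 / p)"
    have c: "cmod (lincomb N g (\<lambda>j. of_real c * a j) t) powr p = cmod (lincomb N g a t) powr p / s" for t
      using s p by (simp add: lincomb_scale norm_mult powr_mult c_def powr_powr)
    define b where "b = (\<lambda>j. of_real c * a j)"
    have "avg_pow M x p (lincomb N g b) = 1"
      using s by (simp add: b_def avg_pow_def c sum_divide_distrib[symmetric]) (use M in \<open>simp add: s_def avg_pow_def\<close>)
    then have "b \<in> B" using scale[OF a] by (simp add: B_def b_def)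
    moreover have "\<delta> * M < \<bar>signed_sum n \<omega> (\<lambda>i. cmod (lincomb N g b (x i)) powr p)\<bar>"
    proof -
      have "signed_sum n \<omega> (\<lambda>i. cmod (lincomb N g b (x i)) powr p)
          = signed_sum n \<omega> (\<lambda>i. cmod (lincomb N g a (x i)) powr p) / s"
        by (simp add: b_def c signed_sum_def sum_divide_distrib diff_divide_distrib right_diff_distrib)
      then show ?thesis using big s
        by (simp add: s_def[symmetric] abs_divide pos_less_divide_eq mult_ac)
    qed
    ultimately show "\<exists>a\<in>B. \<delta> * M < \<bar>signed_sum n \<omega> (\<lambda>i. cmod (lincomb N g a (x i)) powr p)\<bar>"
      by blast
  qed
  have "measure_pmf.prob (coin_flips n)
      {\<omega>. \<exists>a\<in>B. \<delta> * M < \<bar>signed_sum n \<omega> (\<lambda>i. cmod (lincomb N g a (x i)) powr p)\<bar>} < 1 / 2"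
  proof (rule chaining[where W = W and R = R])
    show "(\<lambda>_. 0) \<in> B" using zero_in by (simp add: B_def avg_pow_def lincomb_def)
    show "(\<Sum>i<M. cmod (lincomb N g a (x i)) powr p) \<le> M" if "a \<in> B" for a
      using that M by (simp add: B_def avg_pow_def field_simps)

    show "(l1 N (\<lambda>j. a j - b j))\<^sup>2 \<le> W * t powr (2 - p)" if "a \<in> B" "b \<in> B" "0 < t"
      "\<And>i. i < M \<Longrightarrow> cmod (lincomb N g a (x i) - lincomb N g b (x i)) \<le> t" for a b t
      using that by (intro l1_diff) (auto simp: B_def)
  qed (use assms in auto)
  moreover have "measure_pmf.prob (coin_flips n) {\<omega>. \<exists>a\<in>S. \<delta> * M * avg_pow M x p (lincomb N g a)
       < \<bar>signed_sum n \<omega> (\<lambda>i. cmod (lincomb N g a (x i)) powr p)\<bar>}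
     \<le> measure_pmf.prob (coin_flips n)
      {\<omega>. \<exists>a\<in>B. \<delta> * M < \<bar>signed_sum n \<omega> (\<lambda>i. cmod (lincomb N g a (x i)) powr p)\<bar>}"
    using sub by (intro measure_pmf.finite_measure_mono) auto
  ultimately show ?thesis by linarith
qed

text \<open>
  The two events, for the exponent \<open>p\<close> on \<open>v\<close>-sparse vectors and for the exponent \<open>2\<close> on \<open>2v\<close>-sparse
  vectors, each fail with probability less than one half, so some choice of signs satisfies both.
  The constant \<open>W = 32 K v\<close> of the chaining argument is the product of \<open>2v\<close> from the Cauchy-Schwarz inequality on
  \<open>2v\<close> coefficients, \<open>2K\<close> from the Riesz condition, and \<open>8\<close> from the \<open>p\<close>-norm of a difference; the
  exponent \<open>2\<close> leads to \<open>16 K v\<close> only.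
\<close>
lemma halving:
  fixes p K \<delta> :: real and n N v R :: nat and g :: "nat \<Rightarrow> 'a \<Rightarrow> complex" and x :: "nat \<Rightarrow> 'a"
  assumes p: "0 < p" "p \<le> 2" and K: "1 \<le> K" and v: "1 \<le> v" and M: "1 \<le> n" "M = 2 * n" and N: "1 \<le> N"
    and g_le: "\<And>i j. i < M \<Longrightarrow> j \<in> {1..N} \<Longrightarrow> cmod (g j (x i)) \<le> 1"
    and riesz: "\<And>a. a \<in> sparse_coeffs N (2 * v) \<Longrightarrow>
        (\<Sum>j=1..N. (cmod (a j))\<^sup>2) \<le> 2 * K * avg_pow M x 2 (lincomb N g a)"
    and \<delta>: "0 < \<delta>" and R: "512 * K * v \<le> \<delta>\<^sup>2 * 2 powr (R * p)"
    and large: "1536 * (real R)\<^sup>2 * (32 * K * v) * (2400 / p * ln (8 * real M) * ln (4 * real N + 1)) \<le> M * \<delta>\<^sup>2"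
  shows "\<exists>y. y ` {..<n} \<subseteq> x ` {..<M} \<and>
    (\<forall>a\<in>sparse_coeffs N v. \<bar>avg_pow n y p (lincomb N g a) - avg_pow M x p (lincomb N g a)\<bar>
        \<le> \<delta> * avg_pow M x p (lincomb N g a)) \<and>
    (\<forall>a\<in>sparse_coeffs N (2 * v). \<bar>avg_pow n y 2 (lincomb N g a) - avg_pow M x 2 (lincomb N g a)\<bar>
        \<le> \<delta> * avg_pow M x 2 (lincomb N g a))"
proof -
  have M1: "1 \<le> M" using M by simp
  have Kv: "0 < K * v" using K v by (intro mult_pos_pos) auto
  define bad where "bad = (\<lambda>q w. {\<omega>. \<exists>a\<in>sparse_coeffs N w. \<delta> * M * avg_pow M x q (lincomb N g a)
     < \<bar>signed_sum n \<omega> (\<lambda>i. cmod (lincomb N g a (x i)) powr q)\<bar>})"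
  have "measure_pmf.prob (coin_flips n) (bad p v) < 1 / 2"
    unfolding bad_def
  proof (rule prob_large_signed_sum_less_half[where W = "32 * K * v" and R = R])
    fix a b :: "nat \<Rightarrow> complex" and t :: real
    assume ab: "a \<in> sparse_coeffs N v" "b \<in> sparse_coeffs N v" and t: "0 < t"
      and ua: "avg_pow M x p (lincomb N g a) \<le> 1" and ub: "avg_pow M x p (lincomb N g b) \<le> 1"
      and close: "\<And>i. i < M \<Longrightarrow> cmod (lincomb N g a (x i) - lincomb N g b (x i)) \<le> t"
    let ?u = "\<lambda>j. a j - b j"
    have u: "?u \<in> sparse_coeffs N (2 * v)" using sparse_diff[OF ab] by (simp add: mult_2)
    have "(\<Sum>i<M. cmod (lincomb N g ?u (x i)) powr 2)
        \<le> (\<Sum>i<M. t powr (2 - p) * (4 * (cmod (lincomb N g a (x i)) powr p + cmod (lincomb N g b (x i)) powr p)))"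
    proof (rule sum_mono)
      fix i assume "i \<in> {..<M}"
      then have le: "cmod (lincomb N g ?u (x i)) \<le> t" using close by (simp add: lincomb_diff)
      have "cmod (lincomb N g ?u (x i)) powr 2
          = cmod (lincomb N g ?u (x i)) powr (2 - p) * cmod (lincomb N g ?u (x i)) powr p"
        unfolding powr_add[symmetric] by simp
      also have "\<dots> \<le> t powr (2 - p) * (4 * (cmod (lincomb N g a (x i)) powr p + cmod (lincomb N g b (x i)) powr p))"
        using le p cmod_diff_powr_le[OF p, of "lincomb N g a (x i)" "lincomb N g b (x i)"]
        by (intro mult_mono powr_mono2) (auto simp: lincomb_diff)
      finally show "cmod (lincomb N g ?u (x i)) powr 2
          \<le> t powr (2 - p) * (4 * (cmod (lincomb N g a (x i)) powr p + cmod (lincomb N g b (x i)) powr p))" .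
    qed
    also have "\<dots> = t powr (2 - p) * (4 * (M * avg_pow M x p (lincomb N g a) + M * avg_pow M x p (lincomb N g b)))"
      unfolding sum_distrib_left[symmetric] sum.distrib using M1 by (simp add: avg_pow_def)
    also have "\<dots> \<le> t powr (2 - p) * (4 * (M * 1 + M * 1))"
      using mult_left_mono[OF ua, of M] mult_left_mono[OF ub, of M] by (intro mult_left_mono) auto
    finally have "avg_pow M x 2 (lincomb N g ?u) \<le> 8 * t powr (2 - p)"
      using M1 by (simp add: avg_pow_def field_simps)
    then have "2 * K * avg_pow M x 2 (lincomb N g ?u) \<le> 2 * K * (8 * t powr (2 - p))"
      using K by (intro mult_left_mono) auto
    then have "(\<Sum>j=1..N. (cmod (?u j))\<^sup>2) \<le> 2 * K * (8 * t powr (2 - p))"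
      using riesz[OF u] by linarith
    then have "real (2 * v) * (\<Sum>j=1..N. (cmod (?u j))\<^sup>2) \<le> real (2 * v) * (2 * K * (8 * t powr (2 - p)))"
      by (intro mult_left_mono) auto
    then show "(l1 N ?u)\<^sup>2 \<le> 32 * K * v * t powr (2 - p)"
      using l1_squared_le[OF u] by (simp add: mult_ac)
  qed (use assms M1 Kv zero_in_sparse sparse_scale in auto)
  moreover have "measure_pmf.prob (coin_flips n) (bad 2 (2 * v)) < 1 / 2"
    unfolding bad_def
  proof (rule prob_large_signed_sum_less_half[where W = "32 * K * v" and R = R])
    fix a b :: "nat \<Rightarrow> complex" and t :: real
    assume ab: "a \<in> sparse_coeffs N (2 * v)" "b \<in> sparse_coeffs N (2 * v)" and t: "0 < t"
      and ua: "avg_pow M x 2 (lincomb N g a) \<le> 1" and ub: "avg_pow M x 2 (lincomb N g b) \<le> 1"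
    have l1_unit: "(l1 N c)\<^sup>2 \<le> 4 * K * v"
      if c: "c \<in> sparse_coeffs N (2 * v)" and "avg_pow M x 2 (lincomb N g c) \<le> 1" for c
    proof -
      have "2 * K * avg_pow M x 2 (lincomb N g c) \<le> 2 * K * 1"
        using that K by (intro mult_left_mono) auto
      then have "(\<Sum>j=1..N. (cmod (c j))\<^sup>2) \<le> 2 * K" using riesz[OF c] by simp
      then have "real (2 * v) * (\<Sum>j=1..N. (cmod (c j))\<^sup>2) \<le> real (2 * v) * (2 * K)"
        by (intro mult_left_mono) auto
      then show ?thesis using l1_squared_le[OF c] by (simp add: mult_ac)
    qed
    have "(l1 N (\<lambda>j. a j - b j))\<^sup>2 \<le> (l1 N a + l1 N b)\<^sup>2"
      by (intro power_mono l1_diff_le l1_nonneg)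
    also have "\<dots> \<le> 2 * ((l1 N a)\<^sup>2 + (l1 N b)\<^sup>2)"
      using zero_le_power2[of "l1 N a - l1 N b"] by (simp add: power2_eq_square algebra_simps)
    also have "\<dots> \<le> 2 * (4 * K * v + 4 * K * v)"
      using l1_unit[OF ab(1) ua] l1_unit[OF ab(2) ub] by simp
    also have "\<dots> \<le> 32 * K * v" using Kv by simp
    finally show "(l1 N (\<lambda>j. a j - b j))\<^sup>2 \<le> 32 * K * v * t powr (2 - 2)" using t by simp
  next
    have "2 powr (R * p) \<le> 2 powr (R * (2::real))"
      using p by (intro powr_mono mult_left_mono) auto
    then have "\<delta>\<^sup>2 * 2 powr (R * p) \<le> \<delta>\<^sup>2 * 2 powr (R * (2::real))" by (intro mult_left_mono) auto
    then show "16 * (32 * K * v) \<le> \<delta>\<^sup>2 * 2 powr (real R * 2)" using R by simp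
    have "2400 / 2 * ln (8 * real M) * ln (4 * real N + 1) \<le> 2400 / p * ln (8 * real M) * ln (4 * real N + 1)"
      using p M1 by (intro mult_right_mono divide_left_mono) auto
    then have "1536 * (real R)\<^sup>2 * (32 * K * v) * (2400 / 2 * ln (8 * real M) * ln (4 * real N + 1))
      \<le> 1536 * (real R)\<^sup>2 * (32 * K * v) * (2400 / p * ln (8 * real M) * ln (4 * real N + 1))"
      using Kv by (intro mult_left_mono) auto
    then show "1536 * (real R)\<^sup>2 * (32 * K * v) * (2400 / 2 * ln (8 * real M) * ln (4 * real N + 1)) \<le> M * \<delta>\<^sup>2"
      using large by linarith
  qed (use assms M1 Kv zero_in_sparse sparse_scale in auto)
  ultimately have "(\<Sum>b\<in>UNIV. measure_pmf.prob (coin_flips n) (if b then bad p v else bad 2 (2 * v))) < 1"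
    by (simp add: UNIV_bool)
  then obtain \<omega> where \<omega>: "\<omega> \<notin> bad p v" "\<omega> \<notin> bad 2 (2 * v)"
    using pmf_union_bound[of UNIV "coin_flips n" "\<lambda>b. if b then bad p v else bad 2 (2 * v)"]
    by (metis finite_code UNIV_I)
  define y where "y = (\<lambda>i. if \<omega> i then x i else x (i + n))"
  have key: "avg_pow n y q f - avg_pow M x q f = signed_sum n \<omega> (\<lambda>i. cmod (f (x i)) powr q) / M" for q f
  proof -
    have "2 * (\<Sum>i<n. cmod (f (y i)) powr q) =
      (\<Sum>i<M. cmod (f (x i)) powr q) + signed_sum n \<omega> (\<lambda>i. cmod (f (x i)) powr q)"
      unfolding M(2) sum_lessThan_double signed_sum_def sum.distrib[symmetric] sum_distrib_left
      by (intro sum.cong) (auto simp: y_def)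
    then show ?thesis using M by (simp add: avg_pow_def field_simps)
  qed
  have from_good: "\<bar>avg_pow n y q (lincomb N g a) - avg_pow M x q (lincomb N g a)\<bar>
        \<le> \<delta> * avg_pow M x q (lincomb N g a)" if "\<omega> \<notin> bad q w" "a \<in> sparse_coeffs N w" for q w a
    using that M unfolding key bad_def by (force simp: field_simps)
  have "y ` {..<n} \<subseteq> x ` {..<M}" using M(2) by (auto simp: y_def)
  then show ?thesis using from_good \<omega> by blast
qed

section \<open>Iterated halving\<close>

text \<open>
  Error budget: \<open>tol \<epsilon> i\<close> is the error allowed when \<open>2\<^sup>i m\<close> points are left, and \<open>loss \<epsilon> i\<close> is the
  relative error of the halving that leads from \<open>2 \<cdot> 2\<^sup>i m\<close> to \<open>2\<^sup>i m\<close> points. The losses decay only quadratically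
  in \<open>i\<close>, which the exponential growth of the number of points easily pays for, and
  their sum telescopes.
\<close>
definition tol :: "real \<Rightarrow> nat \<Rightarrow> real" where
  "tol \<epsilon> i = \<epsilon> / 2 * (1 + 1 / (real i + 1))"

definition loss :: "real \<Rightarrow> nat \<Rightarrow> real" where
  "loss \<epsilon> i = \<epsilon> / (4 * (real i + 1) * (real i + 2))"

lemma tol_Suc: "tol \<epsilon> (Suc i) + 2 * loss \<epsilon> i = tol \<epsilon> i"
proof -
  have "1 / (real i + 1) - 1 / (real i + 2) = 1 / ((real i + 1) * (real i + 2))"
    by (simp add: field_simps)
  moreover have "2 * (\<epsilon> / (4 * a * b)) = \<epsilon> / 2 * (1 / (a * b))" for a b :: real by simp
  then have "2 * loss \<epsilon> i = \<epsilon> / 2 * (1 / ((real i + 1) * (real i + 2)))"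
    unfolding loss_def .
  ultimately show ?thesis by (simp add: tol_def algebra_simps)
qed

lemma tol_le:
  assumes "0 \<le> \<epsilon>" shows "tol \<epsilon> i \<le> \<epsilon>"
proof -
  have "\<epsilon> / 2 * (1 + 1 / (real i + 1)) \<le> \<epsilon> / 2 * 2"
    using assms by (intro mult_left_mono) auto
  then show ?thesis by (simp add: tol_def)
qed

definition approximates ::
  "nat \<Rightarrow> (nat \<Rightarrow> 'a) \<Rightarrow> real \<Rightarrow> real \<Rightarrow> (('a \<Rightarrow> complex) \<Rightarrow> real) \<Rightarrow> ('a \<Rightarrow> complex) set \<Rightarrow> bool" where
  "approximates M x q e \<tau> F \<longleftrightarrow> (\<forall>f\<in>F. \<bar>avg_pow M x q f - \<tau> f\<bar> \<le> e * \<tau> f)"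

lemma approximates_trans:
  assumes x: "approximates M x q e \<tau> F" and e: "0 \<le> \<delta>" "e \<le> 1"
    and \<tau>: "\<And>f. f \<in> F \<Longrightarrow> 0 \<le> \<tau> f"
    and y: "\<And>f. f \<in> F \<Longrightarrow> \<bar>avg_pow n y q f - avg_pow M x q f\<bar> \<le> \<delta> * avg_pow M x q f"
  shows "approximates n y q (e + 2 * \<delta>) \<tau> F"
  unfolding approximates_def
proof
  fix f assume f: "f \<in> F"
  have 1: "\<bar>avg_pow M x q f - \<tau> f\<bar> \<le> e * \<tau> f" using x f by (simp add: approximates_def)
  moreover have "e * \<tau> f \<le> 1 * \<tau> f" using e \<tau>[OF f] by (intro mult_right_mono) auto
  ultimately have "avg_pow M x q f \<le> 2 * \<tau> f" by linarith
  then have "\<delta> * avg_pow M x q f \<le> \<delta> * (2 * \<tau> f)" using e by (intro mult_left_mono) auto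
  then show "\<bar>avg_pow n y q f - \<tau> f\<bar> \<le> (e + 2 * \<delta>) * \<tau> f"
    using 1 y[OF f] by (simp add: algebra_simps)
qed

text \<open>
  As the error stays below one half, the Riesz condition for \<open>\<tau> 2\<close> holds with the doubled
  constant \<open>2 K\<close> for every intermediate sequence of points, so each halving is possible.
\<close>
lemma repeated_halving:
  fixes p K \<epsilon> :: real and m N v :: nat and g :: "nat \<Rightarrow> 'a \<Rightarrow> complex" and \<Omega> :: "'a set"
    and \<tau> :: "real \<Rightarrow> ('a \<Rightarrow> complex) \<Rightarrow> real"
  assumes p: "0 < p" "p \<le> 2" and K: "1 \<le> K" and v: "1 \<le> v" and m: "1 \<le> m" and N: "1 \<le> N"
    and \<epsilon>: "0 < \<epsilon>" "\<epsilon> \<le> 1 / 2"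
    and g_le: "\<And>j t. j \<in> {1..N} \<Longrightarrow> t \<in> \<Omega> \<Longrightarrow> cmod (g j t) \<le> 1"
    and \<tau>: "\<And>q f. 0 \<le> \<tau> q f"
    and riesz: "\<And>a. (\<Sum>j=1..N. (cmod (a j))\<^sup>2) \<le> K * \<tau> 2 (lincomb N g a)"
    and large: "\<And>i. \<exists>R. 512 * K * v \<le> (loss \<epsilon> i)\<^sup>2 * 2 powr (real R * p) \<and>
      1536 * (real R)\<^sup>2 * (32 * K * v) * (2400 / p * ln (8 * real (2 ^ Suc i * m)) * ln (4 * real N + 1))
        \<le> real (2 ^ Suc i * m) * (loss \<epsilon> i)\<^sup>2"
    and x: "x ` {..<2 ^ r * m} \<subseteq> \<Omega>"
      "approximates (2 ^ r * m) x p (tol \<epsilon> r) (\<tau> p) (lincomb N g ` sparse_coeffs N v)"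
      "approximates (2 ^ r * m) x 2 (tol \<epsilon> r) (\<tau> 2) (lincomb N g ` sparse_coeffs N (2 * v))"
  shows "\<exists>y. y ` {..<m} \<subseteq> \<Omega> \<and> approximates m y p \<epsilon> (\<tau> p) (lincomb N g ` sparse_coeffs N v)"
  using x
proof (induction r arbitrary: x)
  case 0
  then show ?case by (auto simp: tol_def)
next
  case (Suc r)
  let ?M = "2 ^ Suc r * m" and ?n = "2 ^ r * m" and ?\<delta> = "loss \<epsilon> r"
  have \<delta>: "0 < ?\<delta>" using \<epsilon> by (simp add: loss_def)
  have e: "tol \<epsilon> (Suc r) \<le> 1 / 2" using tol_le[of \<epsilon> "Suc r"] \<epsilon> by simp
  have avg_riesz: "(\<Sum>j=1..N. (cmod (a j))\<^sup>2) \<le> 2 * K * avg_pow ?M x 2 (lincomb N g a)"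
    if "a \<in> sparse_coeffs N (2 * v)" for a
  proof -
    have "\<bar>avg_pow ?M x 2 (lincomb N g a) - \<tau> 2 (lincomb N g a)\<bar> \<le> tol \<epsilon> (Suc r) * \<tau> 2 (lincomb N g a)"
      using Suc.prems(3) that by (auto simp: approximates_def)
    moreover have "tol \<epsilon> (Suc r) * \<tau> 2 (lincomb N g a) \<le> 1 / 2 * \<tau> 2 (lincomb N g a)"
      using e \<tau> by (intro mult_right_mono) auto
    ultimately have "\<tau> 2 (lincomb N g a) \<le> 2 * avg_pow ?M x 2 (lincomb N g a)" by linarith
    then have "K * \<tau> 2 (lincomb N g a) \<le> K * (2 * avg_pow ?M x 2 (lincomb N g a))"
      using K by (intro mult_left_mono) auto
    then show ?thesis using riesz[of a] by simp
  qed
  obtain R where R: "512 * K * v \<le> ?\<delta>\<^sup>2 * 2 powr (real R * p)"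
      "1536 * (real R)\<^sup>2 * (32 * K * v) * (2400 / p * ln (8 * real ?M) * ln (4 * real N + 1)) \<le> real ?M * ?\<delta>\<^sup>2"
    using large by blast
  have n1: "1 \<le> ?n" using m by simp
  have M2: "?M = 2 * ?n" by simp
  have g_le': "cmod (g j (x i)) \<le> 1" if "i < ?M" "j \<in> {1..N}" for i j
    using g_le[OF that(2)] Suc.prems(1) that(1) by blast
  have "\<exists>y. y ` {..<?n} \<subseteq> x ` {..<?M} \<and>
    (\<forall>a\<in>sparse_coeffs N v. \<bar>avg_pow ?n y p (lincomb N g a) - avg_pow ?M x p (lincomb N g a)\<bar>
        \<le> ?\<delta> * avg_pow ?M x p (lincomb N g a)) \<and>
    (\<forall>a\<in>sparse_coeffs N (2 * v). \<bar>avg_pow ?n y 2 (lincomb N g a) - avg_pow ?M x 2 (lincomb N g a)\<bar>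
        \<le> ?\<delta> * avg_pow ?M x 2 (lincomb N g a))"
    by (rule halving[OF p K v n1 M2 N _ _ \<delta> R]) (use g_le' avg_riesz in auto)
  then obtain y where y: "y ` {..<?n} \<subseteq> x ` {..<?M}"
    "\<And>a. a \<in> sparse_coeffs N v \<Longrightarrow> \<bar>avg_pow ?n y p (lincomb N g a) - avg_pow ?M x p (lincomb N g a)\<bar>
        \<le> ?\<delta> * avg_pow ?M x p (lincomb N g a)"
    "\<And>a. a \<in> sparse_coeffs N (2 * v) \<Longrightarrow> \<bar>avg_pow ?n y 2 (lincomb N g a) - avg_pow ?M x 2 (lincomb N g a)\<bar>
        \<le> ?\<delta> * avg_pow ?M x 2 (lincomb N g a)"
    by blast
  show ?case
  proof (rule Suc.IH)
    show "y ` {..<?n} \<subseteq> \<Omega>" using y(1) Suc.prems(1) by blast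
    show "approximates ?n y p (tol \<epsilon> r) (\<tau> p) (lincomb N g ` sparse_coeffs N v)"
      unfolding tol_Suc[symmetric, of \<epsilon> r] using y(2) \<delta> e \<tau>
      by (intro approximates_trans[OF Suc.prems(2)]) auto
    show "approximates ?n y 2 (tol \<epsilon> r) (\<tau> 2) (lincomb N g ` sparse_coeffs N (2 * v))"
      unfolding tol_Suc[symmetric, of \<epsilon> r] using y(3) \<delta> e \<tau>
      by (intro approximates_trans[OF Suc.prems(3)]) auto
  qed
qed

section \<open>The size of the final sample\<close>

lemma ln_le_log2: "1 \<le> y \<Longrightarrow> ln y \<le> log 2 y"
proof -
  assume y: "1 \<le> y"
  have "ln y = log 2 y * ln 2" by (simp add: log_def)
  also have "\<dots> \<le> log 2 y * 1" using y ln_2_less_1 by (intro mult_left_mono) auto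
  finally show ?thesis by simp
qed

lemma power7_le_two_power: "\<exists>D>0. \<forall>j. real j ^ 7 \<le> D * 2 ^ j"
proof -
  have "(\<lambda>j::nat. real j ^ 7 / 2 ^ j) \<longlonglongrightarrow> 0" by real_asymp
  then have "Bseq (\<lambda>j::nat. real j ^ 7 / 2 ^ j)"
    by (intro convergent_imp_Bseq) (auto simp: convergent_def)
  then obtain D where "0 < D" "\<forall>j. norm (real j ^ 7 / 2 ^ j) \<le> D"
    by (rule BseqE)
  then show ?thesis by (intro exI[of _ D]) (auto simp: field_simps)
qed

lemma linear_ge_log: "\<exists>C0\<ge>1. c * (6 + ln (2 * C0)) \<le> (C0::real)"
proof -
  have "eventually (\<lambda>C0. c * (6 + ln (2 * C0)) \<le> (C0::real)) at_top" by real_asymp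
  with eventually_ge_at_top[of 1] have "eventually (\<lambda>C0. 1 \<le> C0 \<and> c * (6 + ln (2 * C0)) \<le> (C0::real)) at_top"
    by (rule eventually_conj)
  then show ?thesis using eventually_happens trivial_limit_at_top_linorder by blast
qed

definition log_factor :: "nat \<Rightarrow> real \<Rightarrow> nat \<Rightarrow> real" where
  "log_factor N K v = log 2 (2 * K * real v) + log 2 (log 2 (2 * real N))"

text \<open>
  The bound of the theorem without its constant. Here \<open>log (1/\<epsilon>)\<close> is grouped with the other
  logarithms, because only their product \<open>X\<close> matters in the estimates: the logarithms of \<open>1/\<epsilon>\<close>, of \<open>K v\<close>
  and of \<open>log N\<close> are all at most \<open>X\<close>.
\<close>
definition size_unit :: "real \<Rightarrow> nat \<Rightarrow> real \<Rightarrow> nat \<Rightarrow> real" where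
  "size_unit \<epsilon> N K v = K * v * log 2 N * (log_factor N K v * log 2 (1 / \<epsilon>)) ^ 3 / \<epsilon>\<^sup>2"

lemma sample_size_bounds:
  fixes \<epsilon> K :: real and N v :: nat
  assumes \<epsilon>: "0 < \<epsilon>" "\<epsilon> \<le> 1 / 2" and N: "2 \<le> N" and K: "1 \<le> K" and v: "1 \<le> v"
  defines "X \<equiv> log_factor N K v * log 2 (1 / \<epsilon>)"
  shows "1 \<le> X" "1 \<le> log 2 (real N)" "1 \<le> K * v" "log 2 (1 / \<epsilon>) \<le> X" "log 2 (K * v) \<le> X"
    "log 2 (log 2 (real N)) \<le> X" "1 \<le> size_unit \<epsilon> N K v" "ln (size_unit \<epsilon> N K v) \<le> 7 * X"
proof -
  have "1 \<le> real v" using v by simp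
  with K have Kv: "1 \<le> K * v" using mult_mono[of 1 K 1 "real v"] by simp
  have l: "1 \<le> log 2 (1 / \<epsilon>)"
    using \<epsilon> by (subst le_log_iff) (auto simp: field_simps)
  have lN: "1 \<le> log 2 (real N)" using N by (subst le_log_iff) auto
  have l2N: "log 2 (2 * real N) = 1 + log 2 N" using N by (simp add: log_mult)
  have lK: "log 2 (2 * K * real v) = 1 + log 2 (K * v)"
    using Kv K v by (simp add: log_mult mult.assoc)
  have nnK: "0 \<le> log 2 (K * v)" using Kv by (rule zero_le_log_cancel_iff[THEN iffD2, rotated 2]) (use Kv in auto)
  have nnN: "0 \<le> log 2 (log 2 (real N))" using lN by (subst zero_le_log_cancel_iff) auto
  have mono: "log 2 (log 2 (real N)) \<le> log 2 (log 2 (2 * real N))"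
    unfolding l2N using lN by (subst log_le_cancel_iff) auto
  have Y: "1 \<le> log_factor N K v" "log 2 (K * v) \<le> log_factor N K v" "log 2 (log 2 (real N)) \<le> log_factor N K v"
    using nnK nnN mono by (auto simp: log_factor_def lK)
  have YX: "log_factor N K v \<le> X"
    unfolding X_def using mult_left_mono[OF l, of "log_factor N K v"] Y by simp
  show X: "1 \<le> X" "log 2 (K * v) \<le> X" "log 2 (log 2 (real N)) \<le> X" using YX Y by auto
  show lX: "log 2 (1 / \<epsilon>) \<le> X"
    unfolding X_def using mult_right_mono[OF Y(1), of "log 2 (1 / \<epsilon>)"] l by simp
  show "1 \<le> K * v" "1 \<le> log 2 (real N)" by fact+
  have inv: "1 \<le> 1 / \<epsilon>" using \<epsilon> by simp
  have su: "size_unit \<epsilon> N K v = K * v * log 2 N * X ^ 3 * (1 / \<epsilon>) ^ 2"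
    by (simp add: size_unit_def X_def power_divide)
  have "1 * 1 * 1 * 1 \<le> K * v * log 2 N * X ^ 3 * (1 / \<epsilon>) ^ 2"
    using K v Kv lN X inv by (intro mult_mono mult_nonneg_nonneg) (auto simp: one_le_power)
  then show "1 \<le> size_unit \<epsilon> N K v" by (simp add: su)
  have "ln (size_unit \<epsilon> N K v) = ln (K * v) + ln (log 2 N) + 3 * ln X + 2 * ln (1 / \<epsilon>)"
    unfolding su using Kv lN X \<epsilon> K v by (simp add: ln_mult ln_realpow)
  also have "\<dots> \<le> X + X + 3 * X + 2 * X"
  proof (intro add_mono mult_left_mono)
    show "ln (K * v) \<le> X" using ln_le_log2[OF Kv] X by linarith
    show "ln (log 2 N) \<le> X" using ln_le_log2[OF lN] X by linarith
    show "ln X \<le> X" using ln_bound[of X] X by simp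
    show "ln (1 / \<epsilon>) \<le> X" using ln_le_log2[OF inv] lX by linarith
  qed auto
  finally show "ln (size_unit \<epsilon> N K v) \<le> 7 * X" by simp
qed

text \<open>
  With \<open>j = i + 2\<close> and \<open>Z = X j\<close>, both \<open>R\<close> and the logarithm of the number of points are of order \<open>Z\<close>.
  Thus the left-hand side of the second condition is of order \<open>(6 + ln (2 C0)) K v log N Z\<^sup>3\<close>, and the
  right-hand side of order \<open>C0 K v log N X\<^sup>3 2\<^sup>j / j\<^sup>4\<close>. The powers of \<open>j\<close> are absorbed by \<open>2\<^sup>j\<close>. The term
  \<open>ln (2 C0)\<close> comes from the logarithm of \<open>m\<close>, so \<open>C0\<close> must dominate a multiple of its own logarithm.
\<close>
lemma sample_size_suffices:
  fixes p :: real
  assumes p: "0 < p" "p \<le> 2"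
  shows "\<exists>C0\<ge>1. \<forall>\<epsilon> N K v i. 0 < \<epsilon> \<longrightarrow> \<epsilon> \<le> 1 / 2 \<longrightarrow> 2 \<le> N \<longrightarrow> 1 \<le> K \<longrightarrow> 1 \<le> v \<longrightarrow>
    (\<exists>R. 512 * K * real v \<le> (loss \<epsilon> i)\<^sup>2 * 2 powr (real R * p) \<and>
      1536 * (real R)\<^sup>2 * (32 * K * v) *
        (2400 / p * ln (8 * real (2 ^ Suc i * nat \<lceil>C0 * size_unit \<epsilon> N K v\<rceil>)) * ln (4 * real N + 1))
      \<le> real (2 ^ Suc i * nat \<lceil>C0 * size_unit \<epsilon> N K v\<rceil>) * (loss \<epsilon> i)\<^sup>2)"
proof -
  obtain D where D: "0 < D" "\<And>j. real j ^ 7 \<le> D * 2 ^ j" using power7_le_two_power by blast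
  define c where "c = 1536 * 169 * 32 * 2400 * 5 * 32 * D / p ^ 3"
  obtain C0 where C0: "1 \<le> C0" "c * (6 + ln (2 * C0)) \<le> C0" using linear_ge_log by blast
  have "\<exists>R. 512 * K * real v \<le> (loss \<epsilon> i)\<^sup>2 * 2 powr (real R * p) \<and>
      1536 * (real R)\<^sup>2 * (32 * K * v) *
        (2400 / p * ln (8 * real (2 ^ Suc i * nat \<lceil>C0 * size_unit \<epsilon> N K v\<rceil>)) * ln (4 * real N + 1))
      \<le> real (2 ^ Suc i * nat \<lceil>C0 * size_unit \<epsilon> N K v\<rceil>) * (loss \<epsilon> i)\<^sup>2"
    if hyps: "0 < \<epsilon>" "\<epsilon> \<le> 1 / 2" "2 \<le> N" "1 \<le> K" "1 \<le> v" for \<epsilon> K :: real and N v i :: nat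
  proof -
    define X where "X = log_factor N K v * log 2 (1 / \<epsilon>)"
    define j where "j = real i + 2"
    define Z where "Z = X * j"
    define Q where "Q = size_unit \<epsilon> N K v"
    define m where "m = nat \<lceil>C0 * Q\<rceil>"
    note b = sample_size_bounds[OF hyps, folded X_def Q_def]
    have j: "2 \<le> j" by (simp add: j_def)
    have "2 * X \<le> Z" "j \<le> Z"
      using mult_left_mono[OF j, of X] mult_right_mono[OF b(1), of j] b(1) j by (auto simp: Z_def)
    then have XZ: "2 * X \<le> Z" "j \<le> Z" "2 \<le> Z" using j by auto
    have CQ: "1 \<le> C0 * Q" using mult_mono[OF C0(1) b(7)] C0(1) by simp
    have m: "C0 * Q \<le> m" "m \<le> 2 * C0 * Q" "1 \<le> real m"
      using CQ unfolding m_def by linarith+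
    have loss2: "(loss \<epsilon> i)\<^sup>2 \<ge> \<epsilon>\<^sup>2 / (16 * j ^ 4)"
    proof -
      have "(4 * (real i + 1) * (real i + 2))\<^sup>2 \<le> (4 * j * j)\<^sup>2"
        by (intro power_mono mult_mono) (auto simp: j_def)
      also have "\<dots> = 16 * j ^ 4" by (simp add: power2_eq_square power4_eq_xxxx)
      finally show ?thesis
        unfolding loss_def power_divide using hyps(1) by (intro divide_left_mono mult_pos_pos) (auto simp: j_def)
    qed
    define L where "L = log 2 (512 * K * v * (16 * j ^ 4) / \<epsilon>\<^sup>2)"
    have Lpos: "0 < 512 * K * v * (16 * j ^ 4) / \<epsilon>\<^sup>2" using hyps j by simp
    have L_le: "L \<le> 12 * Z"
    proof -
      have "512 * K * v * (16 * j ^ 4) / \<epsilon>\<^sup>2 = 2 ^ 13 * (K * v) * j ^ 4 * (1 / \<epsilon>) ^ 2"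
        by (simp add: power_divide)
      then have "L = 13 + log 2 (K * v) + 4 * log 2 j + 2 * log 2 (1 / \<epsilon>)"
        unfolding L_def using hyps j b(3)
        using log2_of_power_eq[of 8192 13]
        by (simp only:) (simp add: log_mult log_nat_power del: power_one_over)
      moreover have "log 2 j \<le> j"
      proof -
        have "real (i + 2) \<le> 2 ^ (i + 2)" by (rule less_imp_le[OF of_nat_less_two_power])
        then have "log 2 j \<le> log 2 (2 ^ (i + 2))" by (subst log_le_cancel_iff) (auto simp: j_def)
        also have "\<dots> = real (i + 2) * log 2 2" by (rule log_nat_power) simp
        finally show ?thesis by (simp add: j_def)
      qed
      ultimately show ?thesis using XZ b(4,5) by linarith
    qed
    define R where "R = nat \<lceil>L / p\<rceil>"
    have R1: "L / p \<le> R" unfolding R_def by linarith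
    have "0 \<le> Z / p" using XZ p by simp
    have "L / p \<le> 12 * Z / p" using L_le p by (intro divide_right_mono) auto
    then have "real R \<le> 12 * Z / p + 1"
      unfolding R_def using \<open>0 \<le> Z / p\<close> by linarith
    also have "1 \<le> Z / p" using XZ p by simp
    finally have R2: "real R \<le> 13 * Z / p" by simp
    have first: "512 * K * v \<le> (loss \<epsilon> i)\<^sup>2 * 2 powr (R * p)"
    proof -
      have "L \<le> R * p" using R1 p by (simp add: field_simps)
      then have "2 powr L \<le> 2 powr (R * p)" by (intro powr_mono) auto
      moreover have "2 powr L = 512 * K * v * (16 * j ^ 4) / \<epsilon>\<^sup>2"
        unfolding L_def using Lpos by (intro powr_log_cancel) auto
      ultimately have "512 * K * v \<le> \<epsilon>\<^sup>2 / (16 * j ^ 4) * 2 powr (R * p)"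
        using hyps j by (simp add: field_simps)
      also have "\<dots> \<le> (loss \<epsilon> i)\<^sup>2 * 2 powr (R * p)"
        using loss2 by (intro mult_right_mono) auto
      finally show ?thesis .
    qed
    have lnM: "ln (8 * real (2 ^ Suc i * m)) \<le> (6 + ln (2 * C0)) * Z"
    proof -
      have "8 * real (2 ^ Suc i * m) = 2 ^ (i + 4) * real m" by (simp add: power_add)
      moreover have "ln (2 ^ (i + 4) * real m) = (i + 4) * ln 2 + ln m"
        using m(3) ln_mult_pos[of "2 ^ (i + 4)" "real m"] ln_realpow[of 2 "i + 4"] by simp
      ultimately have "ln (8 * real (2 ^ Suc i * m)) = (i + 4) * ln 2 + ln m" by (simp only:)
      also have "(i + 4) * ln 2 \<le> real (i + 4) * 1"
        using ln_2_less_1 by (intro mult_left_mono) auto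
      also have "ln m \<le> ln (2 * C0 * Q)" using m by simp
      also have "\<dots> = ln (2 * C0) + ln Q" using C0 b(7) by (simp add: ln_mult)
      finally have "ln (8 * real (2 ^ Suc i * m)) \<le> j + 2 + ln (2 * C0) + 7 * X"
        using b(8) by (simp add: j_def)
      moreover have "ln (2 * C0) * 1 \<le> ln (2 * C0) * Z"
        using C0 XZ by (intro mult_left_mono) auto
      ultimately show ?thesis using XZ by (simp add: distrib_right)
    qed
    have lnN: "ln (4 * real N + 1) \<le> 5 * log 2 N"
    proof -
      have "4 * real N + 1 \<le> real N ^ 5"
      proof -
        have "2 ^ 4 * real N \<le> real N ^ 4 * real N"
          using hyps(3) by (intro mult_right_mono power_mono) auto
        also have "\<dots> = real N ^ 5" by (simp add: eval_nat_numeral)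
        finally show ?thesis using hyps(3) by simp
      qed
      then have "ln (4 * real N + 1) \<le> ln (real N ^ 5)" using hyps(3) by simp
      also have "\<dots> = 5 * ln N" using hyps(3) by (simp add: ln_realpow)
      also have "\<dots> \<le> 5 * log 2 N" using ln_le_log2[of N] hyps(3) by simp
      finally show ?thesis .
    qed
    have lnMnn: "0 \<le> ln (8 * real (2 ^ Suc i * m))" using m(3) by (simp add: mult_ge1_I)
    have lnC: "0 \<le> 6 + ln (2 * C0)" using C0 by simp
    have "1536 * (real R)\<^sup>2 * (32 * K * v) * (2400 / p * ln (8 * real (2 ^ Suc i * m)) * ln (4 * real N + 1))
        \<le> 1536 * (13 * Z / p)\<^sup>2 * (32 * K * v) * (2400 / p * ((6 + ln (2 * C0)) * Z) * (5 * log 2 N))"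
      using R2 lnM lnN lnMnn p hyps lnC XZ
      by (intro mult_mono power_mono mult_nonneg_nonneg) auto
    also have "\<dots> = (c * (6 + ln (2 * C0))) * (Z ^ 3 * (K * v) * log 2 N / (32 * D))"
      unfolding c_def using p D(1) by (simp add: field_simps power2_eq_square power3_eq_cube)
    also have "\<dots> \<le> C0 * (Z ^ 3 * (K * v) * log 2 N / (32 * D))"
      using C0(2) hyps(4) XZ b(2,3) D(1) by (intro mult_right_mono divide_nonneg_nonneg mult_nonneg_nonneg) auto
    also have "\<dots> = C0 * (K * v * log 2 N * X ^ 3) / (16 * j ^ 4) * (j ^ 7 / (2 * D))"
      using j D(1) by (simp add: Z_def field_simps power_mult_distrib eval_nat_numeral)
    also have "\<dots> \<le> C0 * (K * v * log 2 N * X ^ 3) / (16 * j ^ 4) * 2 ^ Suc i"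
    proof (intro mult_left_mono divide_nonneg_nonneg mult_nonneg_nonneg)
      have "j ^ 7 \<le> D * 2 ^ (i + 2)" using D(2)[of "i + 2"] by (simp add: j_def add.commute)
      then show "j ^ 7 / (2 * D) \<le> 2 ^ Suc i" using D(1) by (simp add: field_simps power_add)
    qed (use C0 hyps(4) b j in auto)
    also have "\<dots> = 2 ^ Suc i * (C0 * Q) * (\<epsilon>\<^sup>2 / (16 * j ^ 4))"
      unfolding Q_def size_unit_def X_def using hyps(1) by simp
    also have "\<dots> \<le> 2 ^ Suc i * real m * (loss \<epsilon> i)\<^sup>2"
      using m CQ loss2 by (intro mult_mono mult_left_mono) auto
    finally have second: "1536 * (real R)\<^sup>2 * (32 * K * v) *
        (2400 / p * ln (8 * real (2 ^ Suc i * m)) * ln (4 * real N + 1)) \<le> real (2 ^ Suc i * m) * (loss \<epsilon> i)\<^sup>2"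
      by simp
    show ?thesis using first second unfolding m_def Q_def by blast
  qed
  then show ?thesis using C0(1) by blast
qed

section \<open>Discretizing the measure by many points\<close>

text \<open>
  Every \<open>s\<close> gets its share \<open>M w s\<close> rounded down; the at most \<open>card T\<close> remaining indices go to an arbitrary
  element. So no share is missed by more than one from below, and the total excess is at most \<open>card T\<close>.
\<close>
lemma sequence_with_frequencies:
  fixes w :: "'a \<Rightarrow> real" and M :: nat
  assumes T: "finite T" "T \<noteq> {}" and w: "\<And>s. s \<in> T \<Longrightarrow> 0 \<le> w s" "sum w T = 1"
  shows "\<exists>x. (\<forall>i. x i \<in> T) \<and> (\<Sum>s\<in>T. \<bar>card {i\<in>{..<M}. x i = s} - M * w s\<bar>) \<le> 2 * card T"
proof -
  define n where "n = (\<lambda>s. nat \<lfloor>M * w s\<rfloor>)"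
  define D where "D = Sigma T (\<lambda>s. {..<n s})"
  have n: "real (n s) \<le> M * w s" "M * w s \<le> n s + 1" if "s \<in> T" for s
  proof -
    have "0 \<le> M * w s" using w(1)[OF that] by simp
    then show "real (n s) \<le> M * w s" "M * w s \<le> n s + 1" unfolding n_def by linarith+
  qed
  have "real (card D) = (\<Sum>s\<in>T. real (n s))" using T(1) by (simp add: D_def)
  also have "\<dots> \<le> (\<Sum>s\<in>T. M * w s)" using n by (intro sum_mono) auto
  also have "\<dots> = M" using w(2) by (simp add: sum_distrib_left[symmetric])
  finally have "card D \<le> card {..<M}" by simp
  moreover have "finite D" using T(1) by (simp add: D_def)
  ultimately obtain e where e: "e ` D \<subseteq> {..<M}" "inj_on e D"
    using card_le_inj[of D "{..<M}"] by auto
  obtain t0 where t0: "t0 \<in> T" using T(2) by blast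
  define x where "x = (\<lambda>i. if i \<in> e ` D then fst (inv_into D e i) else t0)"
  have xT: "x i \<in> T" for i
    using inv_into_into[of i e D] t0 by (auto simp: x_def D_def)
  define c where "c = (\<lambda>s. real (card {i\<in>{..<M}. x i = s}))"
  have c_ge: "n s \<le> c s" if s: "s \<in> T" for s
  proof -
    have sub: "Pair s ` {..<n s} \<subseteq> D" using s by (auto simp: D_def)
    have "x (e d) = fst d" if "d \<in> D" for d
      using that by (simp add: x_def inv_into_f_f[OF e(2)])
    then have "inj_on e (Pair s ` {..<n s})" "e ` Pair s ` {..<n s} \<subseteq> {i\<in>{..<M}. x i = s}"
      using sub e inj_on_subset[OF e(2) sub] by force+
    then have "card (Pair s ` {..<n s}) \<le> card {i\<in>{..<M}. x i = s}"
      by (intro card_inj_on_le[of e]) auto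
    then show ?thesis by (simp add: c_def card_image inj_on_def)
  qed
  have c_sum: "sum c T = M"
  proof -
    have "(\<Sum>s\<in>T. card {i\<in>{..<M}. x i = s}) = card {..<M}"
      using sum.group[of "{..<M}" T x "\<lambda>_. 1::nat"] T(1) xT by auto
    then show ?thesis unfolding c_def by (simp flip: of_nat_sum)
  qed
  have "(\<Sum>s\<in>T. \<bar>c s - M * w s\<bar>) \<le> (\<Sum>s\<in>T. (c s - M * w s) + 2)"
    using c_ge n by (intro sum_mono) force
  also have "\<dots> = 2 * card T"
    using c_sum w(2) by (simp add: sum.distrib sum_subtractf sum_distrib_left[symmetric])
  finally show ?thesis using xT by (intro exI[of _ x]) (simp add: c_def)
qed

lemma average_near_weighted_sum:
  fixes h w :: "'a \<Rightarrow> real" and M :: nat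
  assumes T: "finite T" and x: "\<And>i. x i \<in> T" and M: "1 \<le> M"
    and freq: "(\<Sum>s\<in>T. \<bar>card {i\<in>{..<M}. x i = s} - M * w s\<bar>) \<le> c"
    and h: "\<And>s. s \<in> T \<Longrightarrow> \<bar>h s\<bar> \<le> H"
  shows "\<bar>(\<Sum>i<M. h (x i)) / M - (\<Sum>s\<in>T. w s * h s)\<bar> \<le> c / M * H"
proof -
  have "(\<Sum>i<M. h (x i)) = (\<Sum>s\<in>T. \<Sum>i | i \<in> {..<M} \<and> x i = s. h (x i))"
    using T x by (intro sum.group[symmetric]) auto
  also have "\<dots> = (\<Sum>s\<in>T. real (card {i\<in>{..<M}. x i = s}) * h s)"
    by (intro sum.cong) auto
  finally have "(\<Sum>i<M. h (x i)) - M * (\<Sum>s\<in>T. w s * h s)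
      = (\<Sum>s\<in>T. (card {i\<in>{..<M}. x i = s} - M * w s) * h s)"
    by (simp add: sum_distrib_left sum_subtractf algebra_simps)
  also have "\<bar>\<dots>\<bar> \<le> (\<Sum>s\<in>T. \<bar>card {i\<in>{..<M}. x i = s} - M * w s\<bar> * H)"
    using h by (intro order_trans[OF sum_abs] sum_mono) (auto simp: abs_mult intro!: mult_left_mono)
  also have "\<dots> \<le> c * H"
  proof (cases "T = {}")
    case True
    then show ?thesis using x by auto
  next
    case False
    then have "0 \<le> H" using h by (meson abs_ge_zero ex_in_conv order_trans)
    then show ?thesis using freq by (simp add: sum_distrib_right[symmetric] mult_right_mono)
  qed
  finally have "\<bar>(\<Sum>i<M. h (x i)) - M * (\<Sum>s\<in>T. w s * h s)\<bar> / M \<le> c * H / M"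
    by (intro divide_right_mono) auto
  moreover have "(\<Sum>i<M. h (x i)) / M - (\<Sum>s\<in>T. w s * h s) = ((\<Sum>i<M. h (x i)) - M * (\<Sum>s\<in>T. w s * h s)) / M"
    using M by (simp add: field_simps)
  ultimately show ?thesis by (simp add: abs_divide)
qed

text \<open>
  Rounding the real and imaginary parts of all \<open>g j\<close> to a grid splits the space into finitely many
  measurable pieces; \<open>\<pi>\<close> maps each piece to a point in it.
\<close>
lemma finite_valued_projection:
  fixes g :: "nat \<Rightarrow> 'a \<Rightarrow> complex"
  assumes g_meas: "\<And>j. j \<in> {1..N} \<Longrightarrow> g j \<in> borel_measurable \<mu>"
    and g_le: "\<And>j t. j \<in> {1..N} \<Longrightarrow> t \<in> space \<mu> \<Longrightarrow> cmod (g j t) \<le> 1" and \<theta>: "0 < \<theta>"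
  shows "\<exists>T \<pi>. finite T \<and> T \<subseteq> space \<mu> \<and> \<pi> \<in> measurable \<mu> (count_space T) \<and>
    (\<forall>j\<in>{1..N}. \<forall>t\<in>space \<mu>. cmod (g j t - g j (\<pi> t)) \<le> \<theta>)"
proof -
  obtain n :: nat where n: "2 / \<theta> < n" using reals_Archimedean2 by blast
  have n0: "0 < real n" using n \<theta> by (smt (verit) divide_pos_pos)
  define lab where "lab = (\<lambda>t. \<lambda>j\<in>{1..N}. (\<lfloor>n * Re (g j t)\<rfloor>, \<lfloor>n * Im (g j t)\<rfloor>))"
  define L where "L = ({1..N} \<rightarrow>\<^sub>E ({- int n..int n} \<times> {- int n..int n}))"
  have finL: "finite L" unfolding L_def by (intro finite_PiE) auto
  have floor_in: "\<lfloor>n * r\<rfloor> \<in> {- int n..int n}" if "\<bar>r\<bar> \<le> 1" for r :: real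
  proof -
    have "\<bar>n * r\<bar> \<le> n" using that by (simp add: abs_mult mult_left_le)
    then show ?thesis by (auto simp: le_floor_iff floor_le_iff)
  qed
  have labL: "lab t \<in> L" if t: "t \<in> space \<mu>" for t
    unfolding lab_def L_def
    by (intro restrict_PiE_iff[THEN iffD2] ballI SigmaI floor_in
        order_trans[OF abs_Re_le_cmod g_le[OF _ t]] order_trans[OF abs_Im_le_cmod g_le[OF _ t]])
  have lab_meas: "lab \<in> measurable \<mu> (count_space L)"
    unfolding measurable_count_space_eq2[OF finL]
  proof (intro conjI ballI)
    show "lab \<in> space \<mu> \<rightarrow> L" using labL by blast
    fix l assume l: "l \<in> L"
    have "lab -` {l} \<inter> space \<mu> = {t\<in>space \<mu>. \<forall>j\<in>{1..N}. \<lfloor>n * Re (g j t)\<rfloor> = fst (l j) \<and> \<lfloor>n * Im (g j t)\<rfloor> = snd (l j)}"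
      using l by (auto simp: lab_def L_def fun_eq_iff PiE_def extensional_def restrict_def prod_eq_iff)
    also have "\<dots> \<in> sets \<mu>"
      using g_meas by measurable
    finally show "lab -` {l} \<inter> space \<mu> \<in> sets \<mu>" .
  qed
  define r where "r = (\<lambda>l. SOME t. t \<in> space \<mu> \<and> lab t = l)"
  have r: "r (lab t) \<in> space \<mu>" "lab (r (lab t)) = lab t" if "t \<in> space \<mu>" for t
    using someI[of "\<lambda>s. s \<in> space \<mu> \<and> lab s = lab t" t] that by (auto simp: r_def)
  show ?thesis
  proof (intro exI[of _ "r ` lab ` space \<mu>"] exI[of _ "\<lambda>t. r (lab t)"] conjI ballI)
    have sub: "lab ` space \<mu> \<subseteq> L" using labL by blast
    show fin: "finite (r ` lab ` space \<mu>)" using finite_subset[OF sub finL] by simp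
    show "(\<lambda>t. r (lab t)) \<in> measurable \<mu> (count_space (r ` lab ` space \<mu>))"
      unfolding measurable_count_space_eq2[OF fin]
    proof (intro conjI ballI)
      fix s
      have "(\<lambda>t. r (lab t)) -` {s} \<inter> space \<mu> = lab -` {l\<in>L. r l = s} \<inter> space \<mu>"
        using labL by auto
      also have "\<dots> \<in> sets \<mu>" by (rule measurable_sets[OF lab_meas]) auto
      finally show "(\<lambda>t. r (lab t)) -` {s} \<inter> space \<mu> \<in> sets \<mu>" .
    qed auto
    show "r ` lab ` space \<mu> \<subseteq> space \<mu>" using r by auto
    fix j t assume j: "j \<in> {1..N}" and t: "t \<in> space \<mu>"
    let ?s = "r (lab t)"
    have "lab t j = lab ?s j" using r[OF t] by simp
    then have fl: "\<lfloor>n * Re (g j t)\<rfloor> = \<lfloor>n * Re (g j ?s)\<rfloor>" "\<lfloor>n * Im (g j t)\<rfloor> = \<lfloor>n * Im (g j ?s)\<rfloor>"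
      using j by (auto simp: lab_def)
    have close: "\<bar>a - b\<bar> \<le> \<theta> / 2" if "\<lfloor>n * a\<rfloor> = \<lfloor>n * b\<rfloor>" for a b :: real
    proof -
      have "\<bar>n * a - n * b\<bar> \<le> 1" using that by linarith
      then have "n * \<bar>a - b\<bar> \<le> 1" using n0 by (simp add: abs_mult right_diff_distrib[symmetric])
      then have "\<bar>a - b\<bar> \<le> 1 / n" using n0 by (simp add: field_simps)
      also have "\<dots> \<le> \<theta> / 2" using n n0 \<theta> by (simp add: field_simps)
      finally show ?thesis .
    qed
    have "cmod (g j t - g j ?s) \<le> \<bar>Re (g j t - g j ?s)\<bar> + \<bar>Im (g j t - g j ?s)\<bar>"
      by (rule cmod_le)
    also have "\<dots> \<le> \<theta> / 2 + \<theta> / 2" using close[OF fl(1)] close[OF fl(2)] by simp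
    finally show "cmod (g j t - g j ?s) \<le> \<theta>" by simp
  qed
qed

lemma (in prob_space) integral_finite_valued:
  fixes h :: "'b \<Rightarrow> real"
  assumes T: "finite T" and \<pi>: "\<pi> \<in> measurable M (count_space T)"
  shows "(LINT t|M. h (\<pi> t)) = (\<Sum>s\<in>T. prob (\<pi> -` {s} \<inter> space M) * h s)"
    and "integrable M (\<lambda>t. h (\<pi> t))"
    and "(\<Sum>s\<in>T. prob (\<pi> -` {s} \<inter> space M)) = 1"
proof -
  have sets: "\<pi> -` {s} \<inter> space M \<in> sets M" if "s \<in> T" for s
    using measurable_sets[OF \<pi>, of "{s}"] that by simp
  have eq: "h' (\<pi> t) = (\<Sum>s\<in>T. h' s * indicator (\<pi> -` {s} \<inter> space M) t)"
    if "t \<in> space M" for t and h' :: "'b \<Rightarrow> real"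
  proof -
    have "\<pi> t \<in> T" using measurable_space[OF \<pi> that] by simp
    moreover have "(\<Sum>s\<in>T. h' s * indicator (\<pi> -` {s} \<inter> space M) t) = (\<Sum>s\<in>T. if s = \<pi> t then h' s else 0)"
      using that by (intro sum.cong) (auto simp: indicator_def)
    ultimately show ?thesis using T by simp
  qed
  have int: "integrable M (\<lambda>t. \<Sum>s\<in>T. h' s * indicator (\<pi> -` {s} \<inter> space M) t)" for h' :: "'b \<Rightarrow> real"
    using sets by (intro Bochner_Integration.integrable_sum integrable_mult_right integrable_real_indicator)
      (auto simp: emeasure_eq_measure)
  show "integrable M (\<lambda>t. h (\<pi> t))"
    using int[of h] by (subst Bochner_Integration.integrable_cong[OF refl eq]) auto
  have I: "(LINT t|M. h' (\<pi> t)) = (\<Sum>s\<in>T. prob (\<pi> -` {s} \<inter> space M) * h' s)" for h' :: "'b \<Rightarrow> real"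
  proof -
    have "(LINT t|M. h' (\<pi> t)) = (LINT t|M. (\<Sum>s\<in>T. h' s * indicator (\<pi> -` {s} \<inter> space M) t))"
      using eq by (intro Bochner_Integration.integral_cong) auto
    also have "\<dots> = (\<Sum>s\<in>T. (LINT t|M. h' s * indicator (\<pi> -` {s} \<inter> space M) t))"
      using sets by (intro Bochner_Integration.integral_sum integrable_mult_right integrable_real_indicator)
        (auto simp: emeasure_eq_measure)
    also have "\<dots> = (\<Sum>s\<in>T. prob (\<pi> -` {s} \<inter> space M) * h' s)"
      using sets by (intro sum.cong) (auto simp: mult.commute)
    finally show ?thesis .
  qed
  show "(LINT t|M. h (\<pi> t)) = (\<Sum>s\<in>T. prob (\<pi> -` {s} \<inter> space M) * h s)" by (rule I)
  show "(\<Sum>s\<in>T. prob (\<pi> -` {s} \<inter> space M)) = 1" using I[of "\<lambda>_. 1"] by (simp add: prob_space)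
qed

text \<open>
  The absolute error of the sample for \<open>lincomb N g a\<close> is a small multiple of \<open>A powr q\<close>, where \<open>A = l1 N a\<close>.
  It becomes a relative error because \<open>A\<^sup>2 \<le> N K A powr (2 - q) I\<close>, where \<open>I\<close> is the integral of the
  \<open>q\<close>-th power, by the Riesz condition and because the function is bounded by \<open>A\<close>.
\<close>
lemma fine_sample:
  fixes p K e :: real and m N :: nat and g :: "nat \<Rightarrow> 'a \<Rightarrow> complex" and \<mu> :: "'a measure"
  assumes \<mu>: "prob_space \<mu>" and p: "0 < p" "p \<le> 2" and K: "1 \<le> K" and m: "1 \<le> m" and N: "1 \<le> N"
    and e: "0 < e" "e \<le> 1"
    and g_meas: "\<And>j. j \<in> {1..N} \<Longrightarrow> g j \<in> borel_measurable \<mu>"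
    and g_le: "\<And>j t. j \<in> {1..N} \<Longrightarrow> t \<in> space \<mu> \<Longrightarrow> cmod (g j t) \<le> 1"
    and riesz: "\<And>a. (\<Sum>j=1..N. (cmod (a j))\<^sup>2) \<le> K * Lp_norm_pow \<mu> 2 (lincomb N g a)"
  obtains r x where "x ` {..<2 ^ r * m} \<subseteq> space \<mu>"
    "\<And>q. p \<le> q \<Longrightarrow> q \<le> 2 \<Longrightarrow>
      approximates (2 ^ r * m) x q e (Lp_norm_pow \<mu> q) (range (lincomb N g))"
proof -
  interpret prob_space \<mu> by fact
  define \<kappa> where "\<kappa> = N * K"
  have \<kappa>: "1 \<le> \<kappa>" using mult_mono[of 1 "real N" 1 K] N K by (simp add: \<kappa>_def)
  define \<theta> where "\<theta> = (e / (4 * \<kappa>)) powr (2 / p)"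
  have \<theta>: "0 < \<theta>" "\<theta> powr (p / 2) = e / (4 * \<kappa>)" using e \<kappa> p by (auto simp: \<theta>_def powr_powr)
  have "\<theta> \<le> 1" unfolding \<theta>_def using e \<kappa> p by (intro powr_le1) auto
  then have \<theta>_powr: "\<theta> powr (q / 2) \<le> e / (4 * \<kappa>)" if "p \<le> q" for q
    using \<theta> that by (subst \<theta>(2)[symmetric], intro powr_mono') auto
  obtain T \<pi> where T: "finite T" "T \<subseteq> space \<mu>" "\<pi> \<in> measurable \<mu> (count_space T)"
    "\<And>j t. j \<in> {1..N} \<Longrightarrow> t \<in> space \<mu> \<Longrightarrow> cmod (g j t - g j (\<pi> t)) \<le> \<theta>"
    using finite_valued_projection[where N = N and g = g, OF g_meas g_le \<theta>(1)] by auto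
  define w where "w = (\<lambda>s. prob (\<pi> -` {s} \<inter> space \<mu>))"
  have w: "\<And>s. s \<in> T \<Longrightarrow> 0 \<le> w s" "sum w T = 1"
    unfolding w_def using integral_finite_valued(3)[OF T(1,3)] by auto
  have T_ne: "T \<noteq> {}" using w(2) by auto
  obtain r :: nat where r: "4 * \<kappa> * card T / e < 2 ^ r"
    using real_arch_pow[of 2 "4 * \<kappa> * card T / e"] by auto
  define M where "M = 2 ^ r * m"
  have M: "1 \<le> M" "2 ^ r \<le> real M" using m by (auto simp: M_def)
  obtain x where x: "\<And>i. x i \<in> T" "(\<Sum>s\<in>T. \<bar>card {i\<in>{..<M}. x i = s} - M * w s\<bar>) \<le> 2 * card T"
    using sequence_with_frequencies[OF T(1) T_ne w, of M] by auto
  have M_large: "2 * card T / M \<le> e / (2 * \<kappa>)"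
  proof -
    have "4 * \<kappa> * card T / e \<le> M" using r M(2) by linarith
    then show ?thesis using e \<kappa> M by (simp add: field_simps)
  qed
  show thesis
  proof (rule that[of x r])
    show "x ` {..<2 ^ r * m} \<subseteq> space \<mu>" using x(1) T(2) by auto
    fix q assume q: "p \<le> q" "q \<le> 2"
    have "\<bar>avg_pow M x q (lincomb N g a) - Lp_norm_pow \<mu> q (lincomb N g a)\<bar>
        \<le> e * Lp_norm_pow \<mu> q (lincomb N g a)" for a
    proof -
      define A where "A = l1 N a"
      define f where "f = lincomb N g a"
      have f_le: "cmod (f t) \<le> A" if "t \<in> space \<mu>" for t
        unfolding f_def A_def using g_le that by (intro cmod_lincomb_le_l1) auto
      have A0: "0 \<le> A" by (simp add: A_def)
      have f_meas: "f \<in> borel_measurable \<mu>"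
        unfolding f_def lincomb_def[abs_def] using g_meas by (intro borel_measurable_sum borel_measurable_times) auto
      have int: "integrable \<mu> (\<lambda>t. cmod (f t) powr s)" if "0 < s" for s
      proof (rule integrable_const_bound)
        show "AE t in \<mu>. norm (cmod (f t) powr s) \<le> A powr s"
          using f_le that by (intro AE_I2) (auto intro!: powr_mono2)
      qed (use f_meas in measurable)
      have pi_in: "\<pi> t \<in> T" if "t \<in> space \<mu>" for t using measurable_space[OF T(3) that] by simp
      have close: "\<bar>cmod (f t) powr q - cmod (f (\<pi> t)) powr q\<bar> \<le> 2 * A powr q * \<theta> powr (q / 2)"
        if t: "t \<in> space \<mu>" for t
      proof (rule power2_le_imp_le)
        have pt: "\<pi> t \<in> space \<mu>" using pi_in[OF t] T(2) by blast
        have "cmod (f t - f (\<pi> t)) = cmod (\<Sum>j=1..N. a j * (g j t - g j (\<pi> t)))"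
          by (simp add: f_def lincomb_def sum_subtractf right_diff_distrib)
        also have "\<dots> \<le> (\<Sum>j=1..N. cmod (a j) * \<theta>)"
          using T(4)[OF _ t] by (intro order_trans[OF norm_sum] sum_mono) (auto simp: norm_mult intro!: mult_left_mono)
        also have "\<dots> = A * \<theta>" by (simp add: A_def l1_def sum_distrib_right)
        finally have "\<bar>cmod (f t) - cmod (f (\<pi> t))\<bar> \<le> A * \<theta>"
          using norm_triangle_ineq3 order_trans by blast
        then have "(cmod (f t) powr q - cmod (f (\<pi> t)) powr q)\<^sup>2
            \<le> 2 * (A * \<theta>) powr q * (cmod (f t) powr q + cmod (f (\<pi> t)) powr q)"
          using p q by (intro powr_diff_squared_le) auto
        also have "\<dots> \<le> 2 * (A * \<theta>) powr q * (A powr q + A powr q)"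
          using p q f_le[OF t] f_le[OF pt] by (intro mult_left_mono add_mono powr_mono2) auto
        also have "\<dots> = (2 * A powr q * \<theta> powr (q / 2))\<^sup>2"
          using A0 \<theta>(1) by (simp add: powr_mult power2_eq_square powr_add[symmetric])

        finally show "\<bar>cmod (f t) powr q - cmod (f (\<pi> t)) powr q\<bar>\<^sup>2 \<le> (2 * A powr q * \<theta> powr (q / 2))\<^sup>2"
          by simp
      qed simp
      define I where "I = (LINT t|\<mu>. cmod (f t) powr q)"
      define J where "J = (LINT t|\<mu>. cmod (f (\<pi> t)) powr q)"
      have int\<pi>: "integrable \<mu> (\<lambda>t. cmod (f (\<pi> t)) powr q)"
        by (rule integral_finite_valued(2)[OF T(1,3)])
      have intq: "integrable \<mu> (\<lambda>t. cmod (f t) powr q)" using int p q by simp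
      have "\<bar>I - J\<bar> \<le> 2 * A powr q * \<theta> powr (q / 2)"
      proof -
        have "I - J = (LINT t|\<mu>. cmod (f t) powr q - cmod (f (\<pi> t)) powr q)"
          unfolding I_def J_def using intq int\<pi> by simp
        also have "\<bar>\<dots>\<bar> \<le> (LINT t|\<mu>. \<bar>cmod (f t) powr q - cmod (f (\<pi> t)) powr q\<bar>)"
          by (rule integral_abs_bound)
        also have "\<dots> \<le> (LINT t|\<mu>. 2 * A powr q * \<theta> powr (q / 2))"
          using close intq int\<pi> by (intro integral_mono) auto
        also have "\<dots> = 2 * A powr q * \<theta> powr (q / 2)" by (simp add: prob_space)
        finally show ?thesis .
      qed
      also have "\<dots> \<le> 2 * A powr q * (e / (4 * \<kappa>))"
        using \<theta>_powr[OF q(1)] by (intro mult_left_mono) auto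
      finally have IJ: "\<bar>I - J\<bar> \<le> A powr q * (e / (2 * \<kappa>))" by (simp add: mult.commute)
      have J_eq: "J = (\<Sum>s\<in>T. w s * cmod (f s) powr q)"
        unfolding J_def w_def by (rule integral_finite_valued(1)[OF T(1,3)])
      have "\<bar>avg_pow M x q f - J\<bar> \<le> 2 * card T / M * A powr q"
        unfolding avg_pow_def J_eq
        using f_le T(2) p q x by (intro average_near_weighted_sum[OF T(1) x(1) M(1) x(2)]) (auto intro!: powr_mono2)
      also have "\<dots> \<le> e / (2 * \<kappa>) * A powr q" using M_large by (intro mult_right_mono) auto
      finally have AJ: "\<bar>avg_pow M x q f - J\<bar> \<le> e / (2 * \<kappa>) * A powr q" .
      have err: "\<bar>avg_pow M x q f - I\<bar> \<le> e / \<kappa> * A powr q"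
      proof -
        have "e / \<kappa> * A powr q = e / (2 * \<kappa>) * A powr q + A powr q * (e / (2 * \<kappa>))" by simp
        then show ?thesis using IJ AJ by linarith
      qed
      have "A powr q \<le> \<kappa> * I"
      proof (cases "A = 0")
        case True
        then show ?thesis using \<kappa> by (simp add: I_def)
      next
        case False
        then have A: "0 < A" using A0 by simp
        have "A\<^sup>2 \<le> N * (\<Sum>j=1..N. (cmod (a j))\<^sup>2)"
          unfolding A_def by (rule l1_squared_le) (auto simp: sparse_coeffs_def intro: order_trans[OF card_mono[of "{1..N}"]])
        also have "\<dots> \<le> N * (K * Lp_norm_pow \<mu> 2 f)"
          unfolding f_def using riesz by (intro mult_left_mono) auto
        also have "Lp_norm_pow \<mu> 2 f \<le> (LINT t|\<mu>. A powr (2 - q) * cmod (f t) powr q)"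
          unfolding Lp_norm_pow_def
        proof (intro integral_mono int integrable_mult_right)
          fix t assume t: "t \<in> space \<mu>"
          have "cmod (f t) powr 2 = cmod (f t) powr (2 - q) * cmod (f t) powr q"
            unfolding powr_add[symmetric] by simp
          also have "\<dots> \<le> A powr (2 - q) * cmod (f t) powr q"
            using f_le[OF t] q by (intro mult_right_mono powr_mono2) auto
          finally show "cmod (f t) powr 2 \<le> A powr (2 - q) * cmod (f t) powr q" .
        qed (use p q in auto)
        also have "\<dots> = A powr (2 - q) * I" by (simp add: I_def)
        finally have "A\<^sup>2 \<le> A powr (2 - q) * (\<kappa> * I)"
          using N K by (simp add: \<kappa>_def mult_ac)
        moreover have "A\<^sup>2 = A powr (2 - q) * A powr q"
          using A by (simp add: powr_add[symmetric])
        ultimately show ?thesis using A by simp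
      qed
      then have "e / \<kappa> * A powr q \<le> e / \<kappa> * (\<kappa> * I)" using e \<kappa> by (intro mult_left_mono) auto
      also have "\<dots> = e * I" using \<kappa> by simp
      finally show ?thesis using err by (simp add: I_def f_def Lp_norm_pow_def)
    qed
    then show "approximates (2 ^ r * m) x q e (Lp_norm_pow \<mu> q) (range (lincomb N g))"
      by (auto simp: approximates_def M_def)
  qed
qed

section \<open>Spans of dictionary elements and the discretization theorem\<close>

lemma V_space_lincomb:
  assumes f: "f \<in> V_space g J" and J: "J \<subseteq> {1..N}"
  obtains a where "a \<in> sparse_coeffs N (card J)" "f = lincomb N g a"
proof -
  define S where "S = {lincomb N g a | a. \<forall>j. j \<notin> J \<longrightarrow> a j = 0}"
  have "cfun.span (g ` J) \<subseteq> S"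
  proof (rule cfun.span_minimal)
    show "g ` J \<subseteq> S"
    proof
      fix h assume "h \<in> g ` J"
      then obtain j where j: "j \<in> J" "h = g j" by blast
      have "lincomb N g (\<lambda>l. if l = j then 1 else 0) t = g j t" for t
        using j J by (auto simp: lincomb_def if_distrib[of "\<lambda>c. c * _"] cong: if_cong)
      then have "h = lincomb N g (\<lambda>l. if l = j then 1 else 0)" using j(2) by (simp add: fun_eq_iff)
      then show "h \<in> S" using j(1) by (auto simp: S_def)
    qed
    show "cfun.subspace S"
    proof (rule cfun.subspaceI)
      show "0 \<in> S"
        by (auto simp: S_def lincomb_def fun_eq_iff intro!: exI[of _ "\<lambda>_. 0"])
    next
      fix h h' assume "h \<in> S" "h' \<in> S"
      then obtain a b where "h = lincomb N g a" "\<forall>j. j \<notin> J \<longrightarrow> a j = 0"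
          "h' = lincomb N g b" "\<forall>j. j \<notin> J \<longrightarrow> b j = 0"
        by (auto simp: S_def)
      then show "h + h' \<in> S"
        by (auto simp: S_def lincomb_def fun_eq_iff sum.distrib distrib_right intro!: exI[of _ "\<lambda>j. a j + b j"])
    next
      fix c h assume "h \<in> S"
      then obtain a where "h = lincomb N g a" "\<forall>j. j \<notin> J \<longrightarrow> a j = 0" by (auto simp: S_def)
      then show "cscale c h \<in> S"
        by (auto simp: S_def cscale_def lincomb_scale fun_eq_iff intro!: exI[of _ "\<lambda>j. c * a j"])
    qed
  qed
  then obtain a where a: "f = lincomb N g a" "\<forall>j. j \<notin> J \<longrightarrow> a j = 0"
    using f by (auto simp: V_space_def S_def)
  have "card {j\<in>{1..N}. a j \<noteq> 0} \<le> card J"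
    using a(2) J by (intro card_mono finite_subset[OF J]) auto
  then show thesis using that[of a] a(1) by (simp add: sparse_coeffs_def)
qed

lemma Sigma_terms_subset: "Sigma_terms N g v \<subseteq> lincomb N g ` sparse_coeffs N v"
  unfolding Sigma_terms_def using V_space_lincomb by blast

lemma Union_X_spaces: "\<Union> (X_spaces N g v) = Sigma_terms N g v"
  by (auto simp: X_spaces_def Sigma_terms_def)

lemma approximates_mono:
  assumes "approximates M x q e \<tau> F" "e \<le> e'" "F' \<subseteq> F" "\<And>f. 0 \<le> \<tau> f"
  shows "approximates M x q e' \<tau> F'"
  unfolding approximates_def
proof
  fix f assume "f \<in> F'"
  then have "\<bar>avg_pow M x q f - \<tau> f\<bar> \<le> e * \<tau> f" using assms by (auto simp: approximates_def)
  also have "\<dots> \<le> e' * \<tau> f" using assms by (intro mult_right_mono) auto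
  finally show "\<bar>avg_pow M x q f - \<tau> f\<bar> \<le> e' * \<tau> f" .
qed

lemma discretizes_of_approximates:
  assumes y: "approximates m y p e (Lp_norm_pow M p) F" "y ` {..<m} \<subseteq> \<Omega>" and m: "1 \<le> m"
  shows "discretizes \<Omega> M p (1 - e) (1 + e) F m (\<lambda>i. y (i - 1))"
  unfolding discretizes_def
proof (intro conjI ballI)
  show "1 \<le> m" by fact
  show "y (j - 1) \<in> \<Omega>" if "j \<in> {1..m}" for j using that y(2) by auto
  fix f assume "f \<in> F"
  then have "\<bar>avg_pow m y p f - Lp_norm_pow M p f\<bar> \<le> e * Lp_norm_pow M p f"
    using y(1) by (simp add: approximates_def)
  moreover have "(\<Sum>j=1..m. cmod (f (y (j - 1))) powr p) = (\<Sum>i<m. cmod (f (y i)) powr p)"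
    by (rule sum.reindex_bij_witness[of _ Suc "\<lambda>j. j - 1"]) auto
  ultimately show "(1 - e) * Lp_norm_pow M p f \<le> 1 / real m * (\<Sum>j=1..m. cmod (f (y (j - 1))) powr p)"
    "1 / real m * (\<Sum>j=1..m. cmod (f (y (j - 1))) powr p) \<le> (1 + e) * Lp_norm_pow M p f"
    by (auto simp: avg_pow_def algebra_simps abs_le_iff)
qed

text \<open>
  The second bound for an arbitrary probability space. On a compact domain, continuity supplies the
  measurability of the dictionary, and makes the bound on the supremum norm a pointwise one.
\<close>
lemma sparse_discretization:
  fixes p :: real
  assumes p: "0 < p" "p \<le> 2"
  shows "\<exists>C\<ge>1. \<forall>(\<mu>::'a measure) N (g::nat \<Rightarrow> 'a \<Rightarrow> complex) K v \<epsilon>.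
    prob_space \<mu> \<longrightarrow> 2 \<le> N \<longrightarrow> 1 \<le> K \<longrightarrow> 1 \<le> v \<longrightarrow> 0 < \<epsilon> \<longrightarrow> \<epsilon> \<le> 1 / 2 \<longrightarrow>
    (\<forall>j\<in>{1..N}. g j \<in> borel_measurable \<mu> \<and> (\<forall>t\<in>space \<mu>. cmod (g j t) \<le> 1)) \<longrightarrow>
    (\<forall>a. (\<Sum>j=1..N. (cmod (a j))\<^sup>2) \<le> K * Lp_norm_pow \<mu> 2 (lincomb N g a)) \<longrightarrow>
    (\<exists>m \<xi>. real m \<le> C * size_unit \<epsilon> N K v \<and>
      discretizes (space \<mu>) \<mu> p (1 - \<epsilon>) (1 + \<epsilon>) (Sigma_terms N g v) m \<xi>)"
proof -
  obtain C0 where C0: "1 \<le> C0" and large: "\<And>\<epsilon> N K v i. 0 < \<epsilon> \<Longrightarrow> \<epsilon> \<le> 1 / 2 \<Longrightarrow> 2 \<le> N \<Longrightarrow> 1 \<le> K \<Longrightarrow> 1 \<le> v \<Longrightarrow>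
    (\<exists>R. 512 * K * real v \<le> (loss \<epsilon> i)\<^sup>2 * 2 powr (real R * p) \<and>
      1536 * (real R)\<^sup>2 * (32 * K * v) *
        (2400 / p * ln (8 * real (2 ^ Suc i * nat \<lceil>C0 * size_unit \<epsilon> N K v\<rceil>)) * ln (4 * real N + 1))
      \<le> real (2 ^ Suc i * nat \<lceil>C0 * size_unit \<epsilon> N K v\<rceil>) * (loss \<epsilon> i)\<^sup>2)"
    using sample_size_suffices[OF p] by blast
  have "\<exists>m \<xi>. real m \<le> 2 * C0 * size_unit \<epsilon> N K v \<and>
      discretizes (space \<mu>) \<mu> p (1 - \<epsilon>) (1 + \<epsilon>) (Sigma_terms N g v) m \<xi>"
    if \<mu>: "prob_space \<mu>" and N: "2 \<le> N" and K: "1 \<le> K" and v: "1 \<le> v" and \<epsilon>: "0 < \<epsilon>" "\<epsilon> \<le> 1 / 2"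
      and g: "\<forall>j\<in>{1..N}. g j \<in> borel_measurable \<mu> \<and> (\<forall>t\<in>space \<mu>. cmod (g j t) \<le> 1)"
      and riesz: "\<forall>a. (\<Sum>j=1..N. (cmod (a j))\<^sup>2) \<le> K * Lp_norm_pow \<mu> 2 (lincomb N g a)"
    for \<mu> :: "'a measure" and N v :: nat and g :: "nat \<Rightarrow> 'a \<Rightarrow> complex" and K \<epsilon> :: real
  proof -
    define m where "m = nat \<lceil>C0 * size_unit \<epsilon> N K v\<rceil>"
    have "1 \<le> size_unit \<epsilon> N K v" by (rule sample_size_bounds(7)[OF \<epsilon> N K v])
    then have "1 \<le> C0 * size_unit \<epsilon> N K v" using mult_mono[OF C0] C0 by force
    then have m: "1 \<le> m" "m \<le> 2 * C0 * size_unit \<epsilon> N K v" unfolding m_def by linarith+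
    have \<tau>: "0 \<le> Lp_norm_pow \<mu> q f" for q and f :: "'a \<Rightarrow> complex"
      by (simp add: Lp_norm_pow_def)
    have "\<exists>r x. x ` {..<2 ^ r * m} \<subseteq> space \<mu> \<and> (\<forall>q. p \<le> q \<longrightarrow> q \<le> 2 \<longrightarrow>
      approximates (2 ^ r * m) x q (\<epsilon> / 2) (Lp_norm_pow \<mu> q) (range (lincomb N g)))"
      by (rule fine_sample[OF \<mu> p K m(1), of N "\<epsilon> / 2" g]) (use N \<epsilon> g riesz in auto)
    then obtain r x where x: "x ` {..<2 ^ r * m} \<subseteq> space \<mu>"
      "\<And>q. p \<le> q \<Longrightarrow> q \<le> 2 \<Longrightarrow>
        approximates (2 ^ r * m) x q (\<epsilon> / 2) (Lp_norm_pow \<mu> q) (range (lincomb N g))"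
      by blast
    have tol_ge: "\<epsilon> / 2 \<le> tol \<epsilon> r" using \<epsilon> by (simp add: tol_def field_simps)
    have "\<exists>y. y ` {..<m} \<subseteq> space \<mu> \<and> approximates m y p \<epsilon> (Lp_norm_pow \<mu> p) (lincomb N g ` sparse_coeffs N v)"
    proof (rule repeated_halving[OF p K v m(1) _ \<epsilon>])
      show "approximates (2 ^ r * m) x p (tol \<epsilon> r) (Lp_norm_pow \<mu> p) (lincomb N g ` sparse_coeffs N v)"
        "approximates (2 ^ r * m) x 2 (tol \<epsilon> r) (Lp_norm_pow \<mu> 2) (lincomb N g ` sparse_coeffs N (2 * v))"
        using x(2)[of p] x(2)[of 2] p tol_ge \<tau> by (auto intro: approximates_mono)
      show "\<exists>R. 512 * K * real v \<le> (loss \<epsilon> i)\<^sup>2 * 2 powr (real R * p) \<and>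
        1536 * (real R)\<^sup>2 * (32 * K * v) * (2400 / p * ln (8 * real (2 ^ Suc i * m)) * ln (4 * real N + 1))
          \<le> real (2 ^ Suc i * m) * (loss \<epsilon> i)\<^sup>2" for i
        unfolding m_def by (rule large[OF \<epsilon> N K v])
    qed (use N g riesz x(1) \<tau> in auto)
    then obtain y where "y ` {..<m} \<subseteq> space \<mu>"
      "approximates m y p \<epsilon> (Lp_norm_pow \<mu> p) (lincomb N g ` sparse_coeffs N v)" by blast
    then have "discretizes (space \<mu>) \<mu> p (1 - \<epsilon>) (1 + \<epsilon>) (Sigma_terms N g v) m (\<lambda>i. y (i - 1))"
      using m(1) \<tau> by (intro discretizes_of_approximates approximates_mono[OF _ order_refl Sigma_terms_subset]) auto
    then show ?thesis using m(2) by blast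
  qed
  then show ?thesis using C0 by (intro exI[of _ "2 * C0"]) auto
qed

lemma cmod_le_sup_norm:
  assumes "compact \<Omega>" "continuous_on \<Omega> f" "t \<in> \<Omega>"
  shows "cmod (f t) \<le> sup_norm \<Omega> f"
  unfolding sup_norm_def
proof (rule cSUP_upper)
  have "compact ((\<lambda>x. cmod (f x)) ` \<Omega>)"
    using assms by (intro compact_continuous_image continuous_on_norm) auto
  then show "bdd_above ((\<lambda>x. cmod (f x)) ` \<Omega>)"
    by (intro bounded_imp_bdd_above compact_imp_bounded)
qed fact

lemma log_factor_le:
  fixes K :: real
  assumes N: "2 \<le> N" and K: "1 \<le> K" and v: "1 \<le> v"
  shows "0 \<le> log_factor N K v"
    and "log_factor N K v \<le> 2 * (log 2 (2 * K * real v) + log 2 (log 2 (real N)))"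
proof -
  have "1 \<le> real v" using v by simp
  with K have "1 \<le> K * v" using mult_mono[of 1 K 1 "real v"] by simp
  then have lK: "1 \<le> log 2 (2 * K * real v)" by (subst le_log_iff) auto
  have lN: "1 \<le> log 2 (real N)" using N by (subst le_log_iff) auto
  have l2N: "log 2 (2 * real N) = 1 + log 2 N" using N by (simp add: log_mult)
  have "log 2 (log 2 (2 * real N)) \<le> log 2 (2 * log 2 N)"
    unfolding l2N by (subst log_le_cancel_iff) (use lN in auto)
  also have "\<dots> = 1 + log 2 (log 2 N)" using lN by (subst log_mult) auto
  finally have 1: "log 2 (log 2 (2 * real N)) \<le> 1 + log 2 (log 2 N)" .
  have 2: "0 \<le> log 2 (log 2 (real N))" using lN by (subst zero_le_log_cancel_iff) auto
  have "log 2 (log 2 (real N)) \<le> log 2 (log 2 (2 * real N))"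
    unfolding l2N by (subst log_le_cancel_iff) (use lN in auto)
  then show "0 \<le> log_factor N K v" using lK 2 by (simp add: log_factor_def)
  show "log_factor N K v \<le> 2 * (log 2 (2 * K * real v) + log 2 (log 2 (real N)))"
    using lK 1 2 by (simp add: log_factor_def)
qed

theorem theorem1p5:
  fixes p :: real
  assumes "0 < p" and "p \<le> 2"
  shows "\<exists>C>0. \<forall>(d::nat) (\<Omega>::(nat \<Rightarrow> real) set) (M::(nat \<Rightarrow> real) measure)
            (N::nat) (g::nat \<Rightarrow> (nat \<Rightarrow> real) \<Rightarrow> complex) (K::real) (v::nat).
      compactin (Euclidean_space d) \<Omega> \<longrightarrow>
      prob_space M \<longrightarrow>
      sets M = sets (restrict_space borel \<Omega>) \<longrightarrow>
      N \<ge> 2 \<longrightarrow>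
      (\<forall>j\<in>{1..N}. continuous_on \<Omega> (g j) \<and> sup_norm \<Omega> (g j) \<le> 1) \<longrightarrow>
      K \<ge> 1 \<longrightarrow>
      (\<forall>a::nat \<Rightarrow> complex.
          (\<Sum>j=1..N. (cmod (a j))\<^sup>2) \<le> K * Lp_norm_pow M 2 (\<lambda>x. \<Sum>j=1..N. a j * g j x)) \<longrightarrow>
      1 \<le> v \<longrightarrow> v \<le> N \<longrightarrow>
      ereal_of_enat (m_discr \<Omega> M (X_spaces N g v) p)
        \<le> ereal (C * K * real v * log 2 (real N)
                  * (log 2 (2 * K * real v) + log 2 (log 2 (real N))) ^ 3) \<and>
      (\<forall>\<epsilon>::real. 0 < \<epsilon> \<longrightarrow> \<epsilon> \<le> 1/2 \<longrightarrow>
        (\<exists>(m::nat) (\<xi>::nat \<Rightarrow> nat \<Rightarrow> real).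
           real m \<le> C * \<epsilon> powi (-2) * (log 2 (1 / \<epsilon>)) ^ 3 * K * real v * log 2 (real N)
                     * (log 2 (2 * K * real v) + log 2 (log 2 (2 * real N))) ^ 3 \<and>
           discretizes \<Omega> M p (1 - \<epsilon>) (1 + \<epsilon>) (Sigma_terms N g v) m \<xi>))"
proof -
  obtain C1 where C1: "1 \<le> C1" and main: "\<And>(\<mu>::(nat \<Rightarrow> real) measure) N g K v \<epsilon>.
    prob_space \<mu> \<Longrightarrow> 2 \<le> N \<Longrightarrow> 1 \<le> K \<Longrightarrow> 1 \<le> v \<Longrightarrow> 0 < \<epsilon> \<Longrightarrow> \<epsilon> \<le> 1 / 2 \<Longrightarrow>
    \<forall>j\<in>{1..N}. g j \<in> borel_measurable \<mu> \<and> (\<forall>t\<in>space \<mu>. cmod (g j t) \<le> 1) \<Longrightarrow>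
    \<forall>a. (\<Sum>j=1..N. (cmod (a j))\<^sup>2) \<le> K * Lp_norm_pow \<mu> 2 (lincomb N g a) \<Longrightarrow>
    \<exists>m \<xi>. real m \<le> C1 * size_unit \<epsilon> N K v \<and>
      discretizes (space \<mu>) \<mu> p (1 - \<epsilon>) (1 + \<epsilon>) (Sigma_terms N g v) m \<xi>"
    using sparse_discretization[OF assms, where 'a = "nat \<Rightarrow> real"] by blast
  show ?thesis
  \<comment> \<open>The first bound is the second one at \<open>\<epsilon> = 1/2\<close>: there \<open>1/\<epsilon>\<^sup>2 = 4\<close>, and replacing \<open>log log (2 N)\<close> by
    \<open>log log N\<close> costs a factor \<open>2\<close> in the logarithmic factor, hence \<open>8\<close> in its cube.\<close>
  proof (rule exI[of _ "32 * C1"], intro conjI allI impI)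
    show "0 < 32 * C1" using C1 by simp
  next
    fix d :: nat and \<Omega> :: "(nat \<Rightarrow> real) set" and M :: "(nat \<Rightarrow> real) measure"
      and N v :: nat and g :: "nat \<Rightarrow> (nat \<Rightarrow> real) \<Rightarrow> complex" and K :: real
    assume cpt: "compactin (Euclidean_space d) \<Omega>" and M: "prob_space M"
      and sets: "sets M = sets (restrict_space borel \<Omega>)" and N: "2 \<le> N"
      and g: "\<forall>j\<in>{1..N}. continuous_on \<Omega> (g j) \<and> sup_norm \<Omega> (g j) \<le> 1" and K: "1 \<le> K"
      and riesz: "\<forall>a::nat \<Rightarrow> complex.
          (\<Sum>j=1..N. (cmod (a j))\<^sup>2) \<le> K * Lp_norm_pow M 2 (\<lambda>x. \<Sum>j=1..N. a j * g j x)"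
      and v: "1 \<le> v" "v \<le> N"
    have space: "space M = \<Omega>" using sets_eq_imp_space_eq[OF sets] by (simp add: space_restrict_space)
    have cpt': "compact \<Omega>" using cpt by (simp add: compactin_Euclidean_space_iff)
    have g': "\<forall>j\<in>{1..N}. g j \<in> borel_measurable M \<and> (\<forall>t\<in>space M. cmod (g j t) \<le> 1)"
    proof (intro ballI conjI)
      fix j assume j: "j \<in> {1..N}"
      show "g j \<in> borel_measurable M"
        unfolding measurable_cong_sets[OF sets refl]
        using g j by (intro borel_measurable_continuous_on_restrict) auto
      show "cmod (g j t) \<le> 1" if "t \<in> space M" for t
        using cmod_le_sup_norm[OF cpt', of "g j" t] g j that space by fastforce
    qed
    have riesz': "\<forall>a. (\<Sum>j=1..N. (cmod (a j))\<^sup>2) \<le> K * Lp_norm_pow M 2 (lincomb N g a)"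
      using riesz by (simp add: lincomb_def[abs_def])
    note main' = main[OF M N K v(1) _ _ g' riesz', unfolded space]
    have "1 \<le> real v" using v by simp
    with K have Kv: "0 < K * v" by simp
    have lN: "0 \<le> log 2 (real N)" using N by simp
    note Y = log_factor_le[OF N K v(1)]
    show "\<exists>m \<xi>. real m \<le> 32 * C1 * \<epsilon> powi (-2) * (log 2 (1 / \<epsilon>)) ^ 3 * K * real v * log 2 (real N)
                     * (log 2 (2 * K * real v) + log 2 (log 2 (2 * real N))) ^ 3 \<and>
           discretizes \<Omega> M p (1 - \<epsilon>) (1 + \<epsilon>) (Sigma_terms N g v) m \<xi>"
      if \<epsilon>: "0 < \<epsilon>" "\<epsilon> \<le> 1 / 2" for \<epsilon>
    proof -
      obtain m \<xi> where m: "real m \<le> C1 * size_unit \<epsilon> N K v"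
        "discretizes \<Omega> M p (1 - \<epsilon>) (1 + \<epsilon>) (Sigma_terms N g v) m \<xi>"
        using main'[OF \<epsilon>] by blast
      have "0 \<le> size_unit \<epsilon> N K v" using sample_size_bounds(7)[OF \<epsilon> N K v(1)] by simp
      then have "C1 * size_unit \<epsilon> N K v \<le> 32 * C1 * size_unit \<epsilon> N K v" using C1 by simp
      also have "\<dots> = 32 * C1 * \<epsilon> powi (-2) * (log 2 (1 / \<epsilon>)) ^ 3 * K * real v * log 2 (real N)
                     * (log 2 (2 * K * real v) + log 2 (log 2 (2 * real N))) ^ 3"
        unfolding size_unit_def log_factor_def power_mult_distrib power_int_minus
        by (simp add: divide_inverse mult_ac)
      finally show ?thesis using m by (intro exI[of _ m] exI[of _ \<xi>]) auto
    qed
    obtain m \<xi> where m: "real m \<le> C1 * size_unit (1 / 2) N K v"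
      "discretizes \<Omega> M p (1 - 1 / 2) (1 + 1 / 2) (Sigma_terms N g v) m \<xi>"
      using main'[of "1 / 2"] by auto
    have "m_discr \<Omega> M (X_spaces N g v) p \<le> enat m"
      unfolding m_discr_def Union_X_spaces using m(2) by (intro Inf_lower) auto
    then have "ereal_of_enat (m_discr \<Omega> M (X_spaces N g v) p) \<le> ereal_of_enat (enat m)"
      by (simp only: ereal_of_enat_le_iff)
    also have "\<dots> = ereal (real m)" by simp
    also have "real m \<le> 32 * C1 * K * real v * log 2 (real N)
                  * (log 2 (2 * K * real v) + log 2 (log 2 (real N))) ^ 3"
    proof -
      have "log_factor N K v ^ 3 \<le> (2 * (log 2 (2 * K * real v) + log 2 (log 2 (real N)))) ^ 3"
        using Y by (intro power_mono) auto
      also have "\<dots> = 8 * (log 2 (2 * K * real v) + log 2 (log 2 (real N))) ^ 3"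
        unfolding power_mult_distrib by simp
      finally have "C1 * (4 * (K * v) * log 2 N) * log_factor N K v ^ 3
          \<le> C1 * (4 * (K * v) * log 2 N) * (8 * (log 2 (2 * K * real v) + log 2 (log 2 (real N))) ^ 3)"
        using C1 K lN by (intro mult_left_mono mult_nonneg_nonneg) auto
      then show ?thesis using m(1) by (simp add: size_unit_def power2_eq_square mult_ac)
    qed
    finally show "ereal_of_enat (m_discr \<Omega> M (X_spaces N g v) p)
        \<le> ereal (32 * C1 * K * real v * log 2 (real N)
                  * (log 2 (2 * K * real v) + log 2 (log 2 (real N))) ^ 3)"
      by simp
  qed
qed

end
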